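(* Let $P_O=\mathcal{P}_0(m,n)$ be the full orbitope and let $F$ be a non-empty face of $[0,1]^{(m,n)}$ given by index sets $(I_0,I_1)$. Then $\mathrm{Fix}_F(P_O)$ can be computed in linear time $O(mn)$; that is, there is an algorithm which, given $m$, $n$, $I_0$, $I_1$, decides in $O(mn)$ time whether $\mathrm{Fix}_F(P_O)=\varnothing$ and, if not, outputs the index sets $(I_0^{\star},I_1^{\star})$ defining the face $\mathrm{Fix}_F(P_O)$.
   Context: Lexicographic order: for $y,z\in\{0,1\}^m$, $y\succ z$ if there is a row $r\in\{1,\dots,m\}$ with $y_{r'}=z_{r'}$ for all $r'<r$ and $y_r=1$, $z_r=0$; $y\succeq z$ means $y=z$ or $y\succ z$. The full orbitope $\mathcal{P}_0(m,n)$ is the convex hull of all $m\times n$ binary matrices $X$ whose columns satisfy $X(j)\succeq X(j+1)$ for all $j<n$. The face of the cube $C^{(m,n)}=[0,1]^{(m,n)}$ given by disjoint $(I_0,I_1)$, $I_0,I_1\subset\{1,\dots,m\}\times\{1,\dots,n\}$, is $\{x\in[0,1]^{(m,n)} : x_{i,j}=0\ \forall (i,j)\in I_0,\ x_{i,j}=1\ \forall (i,j)\in I_1\}$. For a polytope $P\subset C^{(m,n)}$, $\mathrm{Fix}_F(P)$ is the smallest face of $C^{(m,n)}$ containing $P\cap F\cap\{0,1\}^{(m,n)}$ (the intersection of all faces, including the empty one, containing that set). When it is non-empty, $I_0^{\star}$ and $I_1^{\star}$ denote the index sets giving $\mathrm{Fix}_F(P)$. Running time is counted in elementary operations on matrix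 entries and indices. *)

theory Defs
  imports "HOL-Analysis.Analysis" "HOL-Analysis.Finite_Function_Topology"
begin

section \<open>Full orbitopes and fixing\<close>

text \<open>
  Since \<open>m\<close> and \<open>n\<close> vary (the algorithm is uniform in them), a real
  \<open>m \<times> n\<close> matrix is a point of the real vector space of finitely supported functions on
  \<open>\<nat> \<times> \<nat>\<close> whose support lies in the index grid. Rows and columns are numbered from 1.
\<close>

type_synonym matr = "(nat \<times> nat) \<Rightarrow>\<^sub>0 real"

definition grid :: "nat \<Rightarrow> nat \<Rightarrow> (nat \<times> nat) set" where
  "grid m n = {1..m} \<times> {1..n}"

definition matrices :: "nat \<Rightarrow> nat \<Rightarrow> matr set" where
  "matrices m n = {x. Poly_Mapping.keys x \<subseteq> grid m n}"

definition cube :: "nat \<Rightarrow> nat \<Rightarrow> matr set" where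
  "cube m n = {x \<in> matrices m n. \<forall>p \<in> grid m n. 0 \<le> Poly_Mapping.lookup x p \<and> Poly_Mapping.lookup x p \<le> 1}"

definition binary_matrices :: "nat \<Rightarrow> nat \<Rightarrow> matr set" where
  "binary_matrices m n = {x \<in> matrices m n. \<forall>p \<in> grid m n. Poly_Mapping.lookup x p \<in> {0, 1}}"

definition column :: "matr \<Rightarrow> nat \<Rightarrow> nat \<Rightarrow> real" where
  "column x j = (\<lambda>i. Poly_Mapping.lookup x (i, j))"

definition lex_greater :: "nat \<Rightarrow> (nat \<Rightarrow> real) \<Rightarrow> (nat \<Rightarrow> real) \<Rightarrow> bool" where
  "lex_greater m y z \<longleftrightarrow>
     (\<exists>r \<in> {1..m}. (\<forall>r' \<in> {1..<r}. y r' = z r') \<and> y r = 1 \<and> z r = 0)"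

definition lex_geq :: "nat \<Rightarrow> (nat \<Rightarrow> real) \<Rightarrow> (nat \<Rightarrow> real) \<Rightarrow> bool" where
  "lex_geq m y z \<longleftrightarrow> (\<forall>r \<in> {1..m}. y r = z r) \<or> lex_greater m y z"

definition full_orbitope :: "nat \<Rightarrow> nat \<Rightarrow> matr set" where
  "full_orbitope m n =
     convex hull {X \<in> binary_matrices m n. \<forall>j \<in> {1..<n}. lex_geq m (column X j) (column X (j + 1))}"

definition index_sets :: "nat \<Rightarrow> nat \<Rightarrow> (nat \<times> nat) set \<Rightarrow> (nat \<times> nat) set \<Rightarrow> bool" where
  "index_sets m n I0 I1 \<longleftrightarrow> I0 \<subseteq> grid m n \<and> I1 \<subseteq> grid m n \<and> I0 \<inter> I1 = {}"

definition face :: "nat \<Rightarrow> nat \<Rightarrow> (nat \<times> nat) set \<Rightarrow> (nat \<times> nat) set \<Rightarrow> matr set" where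
  "face m n I0 I1 =
     {x \<in> cube m n. (\<forall>p \<in> I0. Poly_Mapping.lookup x p = 0) \<and> (\<forall>p \<in> I1. Poly_Mapping.lookup x p = 1)}"

definition cube_faces :: "nat \<Rightarrow> nat \<Rightarrow> matr set set" where
  "cube_faces m n = insert {} {face m n I0 I1 | I0 I1. index_sets m n I0 I1}"

definition Fix :: "nat \<Rightarrow> nat \<Rightarrow> matr set \<Rightarrow> matr set \<Rightarrow> matr set" where
  "Fix m n F P = \<Inter> {G \<in> cube_faces m n. P \<inter> F \<inter> binary_matrices m n \<subseteq> G}"


section \<open>Elementary operations\<close>

text \<open>
  Algorithms are programs of a small imperative language over natural-number registers and
  two-dimensional arrays with random access. A program is a finite syntactic object that does not
  depend on the input. The only arithmetic is successor and (truncated) predecessor, so within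
  \<open>t\<close> steps a program can only reach values exceeding the initial ones by \<open>O(t)\<close>, and packing
  a whole column into one number at unit cost is impossible.
\<close>

record state =
  reg :: "string \<Rightarrow> nat"
  arr :: "string \<Rightarrow> nat \<Rightarrow> nat \<Rightarrow> nat"

datatype aexp =
    ANum nat
  | AReg string
  | AEntry string aexp aexp
  | ASucc aexp
  | APred aexp

datatype bexp =
    BEq aexp aexp
  | BLess aexp aexp
  | BNot bexp
  | BAnd bexp bexp

datatype com =
    Skip
  | SetReg string aexp
  | SetEntry string aexp aexp aexp
  | Seq com com
  | Cond bexp com com
  | While bexp com

primrec aval :: "aexp \<Rightarrow> state \<Rightarrow> nat" where
  "aval (ANum k) s = k"
| "aval (AReg x) s = reg s x"
| "aval (AEntry A a b) s = arr s A (aval a s) (aval b s)"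
| "aval (ASucc a) s = aval a s + 1"
| "aval (APred a) s = aval a s - 1"

primrec bval :: "bexp \<Rightarrow> state \<Rightarrow> bool" where
  "bval (BEq a b) s \<longleftrightarrow> aval a s = aval b s"
| "bval (BLess a b) s \<longleftrightarrow> aval a s < aval b s"
| "bval (BNot b) s \<longleftrightarrow> \<not> bval b s"
| "bval (BAnd b c) s \<longleftrightarrow> bval b s \<and> bval c s"

text \<open>Evaluating an expression costs one unit for every node of its syntax tree.\<close>

primrec acost :: "aexp \<Rightarrow> nat" where
  "acost (ANum k) = 1"
| "acost (AReg x) = 1"
| "acost (AEntry A a b) = 1 + acost a + acost b"
| "acost (ASucc a) = 1 + acost a"
| "acost (APred a) = 1 + acost a"

primrec bcost :: "bexp \<Rightarrow> nat" where
  "bcost (BEq a b) = 1 + acost a + acost b"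
| "bcost (BLess a b) = 1 + acost a + acost b"
| "bcost (BNot b) = 1 + bcost b"
| "bcost (BAnd b c) = 1 + bcost b + bcost c"

definition set_reg :: "string \<Rightarrow> nat \<Rightarrow> state \<Rightarrow> state" where
  "set_reg x v s = s\<lparr>reg := (reg s)(x := v)\<rparr>"

definition set_entry :: "string \<Rightarrow> nat \<Rightarrow> nat \<Rightarrow> nat \<Rightarrow> state \<Rightarrow> state" where
  "set_entry A i j v s =
     s\<lparr>arr := (arr s)(A := (arr s A)(i := (arr s A i)(j := v)))\<rparr>"

text \<open>
  \<open>exec c s t s'\<close>: started in \<open>s\<close>, program \<open>c\<close> halts in \<open>s'\<close> after \<open>t\<close> elementary operations.
\<close>

inductive exec :: "com \<Rightarrow> state \<Rightarrow> nat \<Rightarrow> state \<Rightarrow> bool" where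
  Skip: "exec Skip s 1 s"
| SetReg: "exec (SetReg x a) s (1 + acost a) (set_reg x (aval a s) s)"
| SetEntry: "exec (SetEntry A a b c) s (1 + acost a + acost b + acost c)
     (set_entry A (aval a s) (aval b s) (aval c s) s)"
| Seq: "exec c1 s t1 s1 \<Longrightarrow> exec c2 s1 t2 s2 \<Longrightarrow> exec (Seq c1 c2) s (t1 + t2) s2"
| CondTrue: "bval b s \<Longrightarrow> exec c1 s t s' \<Longrightarrow> exec (Cond b c1 c2) s (1 + bcost b + t) s'"
| CondFalse: "\<not> bval b s \<Longrightarrow> exec c2 s t s' \<Longrightarrow> exec (Cond b c1 c2) s (1 + bcost b + t) s'"
| WhileFalse: "\<not> bval b s \<Longrightarrow> exec (While b c) s (1 + bcost b) s"
| WhileTrue: "bval b s \<Longrightarrow> exec c s t1 s1 \<Longrightarrow> exec (While b c) s1 t2 s2 \<Longrightarrow>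
     exec (While b c) s (1 + bcost b + t1 + t2) s2"

inductive_cases exec_SkipE: "exec Skip s t s'"
inductive_cases exec_SetRegE: "exec (SetReg x a) s t s'"
inductive_cases exec_SetEntryE: "exec (SetEntry A a b c) s t s'"
inductive_cases exec_SeqE: "exec (Seq c1 c2) s t s'"
inductive_cases exec_CondE: "exec (Cond b c1 c2) s t s'"
inductive_cases exec_WhileE: "exec (While b c) s t s'"

text \<open>Hence an existential statement about runs speaks about the only run.\<close>

lemma exec_deterministic:
  "exec c s t s' \<Longrightarrow> exec c s u s'' \<Longrightarrow> u = t \<and> s'' = s'"
proof (induction arbitrary: u s'' rule: exec.induct)
  case (Seq c1 s t1 s1 c2 t2 s2)
  from Seq.prems obtain u1 r u2 where "u = u1 + u2" "exec c1 s u1 r" "exec c2 r u2 s''"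
    by (rule exec_SeqE)
  with Seq.IH show ?case by metis
next
  case (WhileTrue b s c t1 s1 t2 s2)
  from WhileTrue.prems WhileTrue.hyps(1) obtain u1 r u2 where
    "u = 1 + bcost b + u1 + u2" "exec c s u1 r" "exec (While b c) r u2 s''"
    by (auto elim: exec_WhileE)
  with WhileTrue.IH show ?case by metis
next
  case (CondTrue b s c1 t s' c2)
  from CondTrue.prems CondTrue.hyps(1) obtain v where "u = 1 + bcost b + v" "exec c1 s v s''"
    by (auto elim: exec_CondE)
  with CondTrue.IH show ?case by metis
next
  case (CondFalse b s c2 t s' c1)
  from CondFalse.prems CondFalse.hyps(1) obtain v where "u = 1 + bcost b + v" "exec c2 s v s''"
    by (auto elim: exec_CondE)
  with CondFalse.IH show ?case by metis
next
  case (WhileFalse b s c)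
  from WhileFalse.prems WhileFalse.hyps show ?case
    by (auto elim: exec_WhileE)
next
  case Skip
  then show ?case by (auto elim: exec_SkipE)
next
  case SetReg
  then show ?case by (auto elim: exec_SetRegE)
next
  case SetEntry
  then show ?case by (auto elim: exec_SetEntryE)
qed

definition stores_set ::
  "state \<Rightarrow> string \<Rightarrow> nat \<Rightarrow> nat \<Rightarrow> (nat \<times> nat) set \<Rightarrow> bool" where
  "stores_set s A m n I \<longleftrightarrow>
     (\<forall>i \<in> {1..m}. \<forall>j \<in> {1..n}. arr s A i j = (if (i, j) \<in> I then 1 else 0))"

text \<open>All registers and array entries not mentioned here hold arbitrary initial values.\<close>

definition holds_input ::
  "state \<Rightarrow> nat \<Rightarrow> nat \<Rightarrow> (nat \<times> nat) set \<Rightarrow> (nat \<times> nat) set \<Rightarrow> bool" where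
  "holds_input s m n I0 I1 \<longleftrightarrow>
     reg s ''m'' = m \<and> reg s ''n'' = n \<and> stores_set s ''I0'' m n I0 \<and> stores_set s ''I1'' m n I1"

end

theory Submission
  imports Defs
begin

text \<open>
  A binary matrix in the orbitope is one of the binary matrices spanning it, because a vertex of the
  cube is not a proper convex combination of other points of the cube. So the fixing problem is about
  the set \<open>solutions m n I0 I1\<close> of binary matrices that respect \<open>I0\<close> and \<open>I1\<close> and whose columns
  weakly decrease lexicographically from left to right: if this set is empty, so is the fixed face;
  otherwise the fixed face prescribes exactly the entries on which all solutions agree
  (\<open>Fix_full_orbitope_empty_iff\<close>, \<open>Fix_full_orbitope_nonempty\<close>).

  Going from the last column to the first and always choosing the least column that respects the
  prescriptions and is not smaller than its right neighbour gives, if there are solutions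
  at all, a solution \<open>lo\<close> that is least in every column at once. Symmetrically there is a solution \<open>hi\<close> that is greatest in every column.
  If \<open>x\<close> respects the prescriptions of column \<open>j\<close> and lies between \<open>lo j\<close> and \<open>hi j\<close>, then taking
  \<open>hi\<close> to the left of \<open>j\<close>, \<open>x\<close> at \<open>j\<close> and \<open>lo\<close> to the right of \<open>j\<close> is again a solution
  (\<open>solution_splice\<close>), so each column, taken by itself, ranges over all fitting columns of a
  lexicographic interval. Within such an interval the rows above the first difference of \<open>lo j\<close>
  and \<open>hi j\<close> are fixed. At the first difference both values occur, and below it every entry outside
  \<open>I0 \<union> I1\<close> is free: raising an entry of \<open>lo j\<close> or lowering one of \<open>hi j\<close> below that row does not leave
  the interval (\<open>common_value_iff\<close>).

  The least fitting column above a column \<open>w\<close> is found with two passes over the rows. The upward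
  pass records, for every row, whether the part of \<open>w\<close> from that row on has a fitting column above
  it. The downward pass copies \<open>w\<close> as long as this stays possible, then puts a one over a zero of
  \<open>w\<close> and continues with the smallest admissible entries (\<open>least_column_greedy\<close>). This costs
  \<open>O(m)\<close> per column. Complementing all entries reverses the order and swaps the roles of \<open>I0\<close> and
  \<open>I1\<close>, so the same program computes the complement of \<open>hi\<close>, from the first column to the last.
  A third sweep compares the two matrices and writes the output.
\<close>

section \<open>Lexicographic order on suffixes of columns\<close>

text \<open>
  The comparison starts at row \<open>i\<close>, so that the suffixes which the two passes meet are compared
  by the same notion as whole columns.
\<close>

definition lex_le :: "nat \<Rightarrow> nat \<Rightarrow> (nat \<Rightarrow> bool) \<Rightarrow> (nat \<Rightarrow> bool) \<Rightarrow> bool" where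
  "lex_le i m x y \<longleftrightarrow>
     (\<forall>r \<in> {i..m}. x r = y r) \<or>
     (\<exists>r \<in> {i..m}. (\<forall>r' \<in> {i..<r}. x r' = y r') \<and> \<not> x r \<and> y r)"

lemma lex_le_past_end: "lex_le (Suc m) m x y"
  by (simp add: lex_le_def)

lemma lex_le_Suc:
  assumes "i \<le> m"
  shows "lex_le i m x y \<longleftrightarrow> (\<not> x i \<and> y i) \<or> (x i = y i \<and> lex_le (Suc i) m x y)"
proof -
  have rows: "{i..m} = insert i {Suc i..m}"
    using assms by auto
  have all: "(\<forall>r \<in> {i..m}. P r) \<longleftrightarrow> P i \<and> (\<forall>r \<in> {Suc i..m}. P r)" for P
    unfolding rows by simp
  have ex: "(\<exists>r \<in> {i..m}. P r) \<longleftrightarrow> P i \<or> (\<exists>r \<in> {Suc i..m}. P r)" for P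
    unfolding rows by simp
  have prefix: "(\<forall>r' \<in> {i..<r}. P r') \<longleftrightarrow> P i \<and> (\<forall>r' \<in> {Suc i..<r}. P r')"
    if "r \<in> {Suc i..m}" for r P
  proof -
    have "{i..<r} = insert i {Suc i..<r}" using that by auto
    then show ?thesis by simp
  qed
  have "(\<exists>r \<in> {Suc i..m}. (\<forall>r' \<in> {i..<r}. x r' = y r') \<and> \<not> x r \<and> y r) \<longleftrightarrow>
      x i = y i \<and> (\<exists>r \<in> {Suc i..m}. (\<forall>r' \<in> {Suc i..<r}. x r' = y r') \<and> \<not> x r \<and> y r)"
    using prefix[of _ "\<lambda>r'. x r' = y r'"] by blast
  then show ?thesis
    unfolding lex_le_def all ex by auto
qed

lemma lex_le_refl: "lex_le i m x x"
  by (simp add: lex_le_def)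

lemma lex_le_pointwise:
  assumes "\<And>r. r \<in> {i..m} \<Longrightarrow> x r \<Longrightarrow> y r" and "i \<le> Suc m"
  shows "lex_le i m x y"
  using assms(2,1)
proof (induction rule: inc_induct)
  case base
  show ?case by (rule lex_le_past_end)
next
  case (step i)
  then have "x i \<Longrightarrow> y i" "lex_le (Suc i) m x y" by auto
  with step.hyps show ?case by (auto simp: lex_le_Suc)
qed

lemma lex_le_trans:
  assumes "lex_le i m x y" "lex_le i m y z" "i \<le> Suc m"
  shows "lex_le i m x z"
  using assms(3,1,2)
proof (induction rule: inc_induct)
  case base
  show ?case by (rule lex_le_past_end)
next
  case (step i)
  then show ?case by (auto simp: lex_le_Suc)
qed

lemma lex_le_complement:
  "lex_le i m (\<lambda>r. \<not> x r) (\<lambda>r. \<not> y r) \<longleftrightarrow> lex_le i m y x"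
proof -
  have eq: "(\<not> x r) = (\<not> y r) \<longleftrightarrow> y r = x r" for r by auto
  show ?thesis unfolding lex_le_def eq by (simp add: conj_ac)
qed

lemma lex_le_drop_prefix:
  assumes "\<forall>r \<in> {1..<i}. x r = y r" "1 \<le> i" "i \<le> Suc m"
  shows "lex_le 1 m x y \<longleftrightarrow> lex_le i m x y"
  using assms(2,1,3)
proof (induction i rule: dec_induct)
  case base
  show ?case ..
next
  case (step i)
  then have "x i = y i" "lex_le 1 m x y \<longleftrightarrow> lex_le i m x y" by auto
  with step.prems show ?case by (auto simp: lex_le_Suc)
qed

lemma lex_le_sandwich:
  assumes "lex_le 1 m x y" "lex_le 1 m y z" "\<forall>r \<in> {1..i}. x r = z r" "i \<le> m" "r \<in> {1..i}"
  shows "y r = x r"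
proof -
  have "\<forall>r \<in> {1..i}. y r = x r"
    using assms(4,3)
  proof (induction i)
    case (Suc i)
    then have IH: "\<forall>r \<in> {1..i}. y r = x r" by auto
    with Suc.prems have "\<forall>r \<in> {1..<Suc i}. x r = y r" "\<forall>r \<in> {1..<Suc i}. y r = z r" by auto
    then have "lex_le (Suc i) m x y" "lex_le (Suc i) m y z"
      using assms(1,2) Suc.prems lex_le_drop_prefix[of "Suc i"] by auto
    moreover have "x (Suc i) = z (Suc i)" using Suc.prems by simp
    ultimately have "y (Suc i) = x (Suc i)"
      using Suc.prems by (auto simp: lex_le_Suc)
    with IH show ?case by (auto simp: le_Suc_eq)
  qed simp
  with assms(5) show ?thesis by blast
qed

section \<open>The least column above a given one\<close>

text \<open>
  \<open>Z\<close> and \<open>I\<close> hold at the rows where a zero, respectively a one, is prescribed.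
\<close>

definition fits :: "nat \<Rightarrow> nat \<Rightarrow> (nat \<Rightarrow> bool) \<Rightarrow> (nat \<Rightarrow> bool) \<Rightarrow> (nat \<Rightarrow> bool) \<Rightarrow> bool" where
  "fits i m Z I x \<longleftrightarrow> (\<forall>r \<in> {i..m}. (Z r \<longrightarrow> \<not> x r) \<and> (I r \<longrightarrow> x r))"

text \<open>
  \<open>w\<close> is the lower bound that a column has to meet.
\<close>

definition feasible :: "nat \<Rightarrow> nat \<Rightarrow> (nat \<Rightarrow> bool) \<Rightarrow> (nat \<Rightarrow> bool) \<Rightarrow> (nat \<Rightarrow> bool) \<Rightarrow> bool" where
  "feasible i m Z I w \<longleftrightarrow> (\<exists>x. fits i m Z I x \<and> lex_le i m w x)"

definition keep :: "nat \<Rightarrow> (nat \<Rightarrow> bool) \<Rightarrow> (nat \<Rightarrow> bool) \<Rightarrow> (nat \<Rightarrow> bool) \<Rightarrow> nat \<Rightarrow> bool" where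
  "keep m Z I w r \<longleftrightarrow> feasible (Suc r) m Z I w \<and> \<not> (w r \<and> Z r) \<and> \<not> (\<not> w r \<and> I r)"

lemma fits_Suc:
  assumes "i \<le> m"
  shows "fits i m Z I x \<longleftrightarrow> (Z i \<longrightarrow> \<not> x i) \<and> (I i \<longrightarrow> x i) \<and> fits (Suc i) m Z I x"
  
proof -
  have "{i..m} = insert i {Suc i..m}" using assms by auto
  then show ?thesis unfolding fits_def by auto
qed

lemma feasible_past_end: "feasible (Suc m) m Z I w"
  by (simp add: feasible_def fits_def lex_le_past_end)

text \<open>
  A suffix reaches the bound in one of two ways: it ties with \<open>w\<close> in its top row and reaches the
  bound below, or it exceeds \<open>w\<close> in the top row, after which the rows below are not bounded any
  more. In the second case the column \<open>I\<close> of prescribed ones fits the remaining rows. This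
  recurrence is what the upward pass evaluates.
\<close>

lemma feasible_Suc:
  assumes "i \<le> m" and consistent: "\<And>r. r \<in> {i..m} \<Longrightarrow> \<not> (Z r \<and> I r)"
  shows "feasible i m Z I w \<longleftrightarrow> keep m Z I w i \<or> (\<not> w i \<and> \<not> Z i)"
proof
  assume "feasible i m Z I w"
  then show "keep m Z I w i \<or> (\<not> w i \<and> \<not> Z i)"
    using assms(1) unfolding feasible_def keep_def by (auto simp: fits_Suc lex_le_Suc)
next
  assume "keep m Z I w i \<or> (\<not> w i \<and> \<not> Z i)"
  then show "feasible i m Z I w"
  proof
    assume keep: "keep m Z I w i"
    then obtain x where x: "fits (Suc i) m Z I x" "lex_le (Suc i) m w x"
      by (auto simp: keep_def feasible_def)
    have "fits (Suc i) m Z I (x(i := w i))" "lex_le (Suc i) m w (x(i := w i))"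
      using x by (auto simp: fits_def lex_le_def)
    with keep have "fits i m Z I (x(i := w i)) \<and> lex_le i m w (x(i := w i))"
      by (auto simp: fits_Suc[OF assms(1)] lex_le_Suc[OF assms(1)] keep_def)
    then show ?thesis unfolding feasible_def by blast
  next
    assume "\<not> w i \<and> \<not> Z i"
    moreover have "fits (Suc i) m Z I (I(i := True))"
      using consistent by (auto simp: fits_def)
    ultimately have "fits i m Z I (I(i := True)) \<and> lex_le i m w (I(i := True))"
      by (auto simp: fits_Suc[OF assms(1)] lex_le_Suc[OF assms(1)])
    then show ?thesis unfolding feasible_def by blast
  qed
qed

text \<open>
  Closed form of the downward pass: \<open>w\<close> is copied up to the first row that cannot be kept, this row
  gets a one, and every later row gets its smallest admissible value.
\<close>

definition greedy :: "nat \<Rightarrow> (nat \<Rightarrow> bool) \<Rightarrow> (nat \<Rightarrow> bool) \<Rightarrow> (nat \<Rightarrow> bool) \<Rightarrow> nat \<Rightarrow> bool" where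
  "greedy m Z I w r =
     (if \<forall>r' \<in> {1..r}. keep m Z I w r' then w r
      else if \<forall>r' \<in> {1..<r}. keep m Z I w r' then True
      else I r)"

definition least_column ::
  "nat \<Rightarrow> (nat \<Rightarrow> bool) \<Rightarrow> (nat \<Rightarrow> bool) \<Rightarrow> (nat \<Rightarrow> bool) \<Rightarrow> (nat \<Rightarrow> bool) \<Rightarrow> bool" where
  "least_column m Z I w x \<longleftrightarrow>
     fits 1 m Z I x \<and> lex_le 1 m w x \<and>
     (\<forall>y. fits 1 m Z I y \<longrightarrow> lex_le 1 m w y \<longrightarrow> lex_le 1 m x y)"

lemma lex_le_cong:
  assumes "\<And>r. r \<in> {i..m} \<Longrightarrow> x r = x' r" "\<And>r. r \<in> {i..m} \<Longrightarrow> y r = y' r"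
  shows "lex_le i m x y \<longleftrightarrow> lex_le i m x' y'"
  unfolding lex_le_def using assms by (intro arg_cong2[where f="(\<or>)"] ball_cong bex_cong) auto

lemma fits_cong:
  assumes "\<And>r. r \<in> {i..m} \<Longrightarrow> x r = x' r"
  shows "fits i m Z I x \<longleftrightarrow> fits i m Z I x'"
  using assms by (simp add: fits_def)

lemma least_column_cong:
  assumes "\<And>r. r \<in> {1..m} \<Longrightarrow> w r = w' r" "\<And>r. r \<in> {1..m} \<Longrightarrow> x r = x' r"
  shows "least_column m Z I w x \<longleftrightarrow> least_column m Z I w' x'"
  unfolding least_column_def
  using assms lex_le_cong[of 1 m w w'] lex_le_cong[of 1 m x x'] fits_cong[of 1 m x x']
  by (metis (no_types, lifting))

text \<open>
  If some row cannot be kept, let \<open>b\<close> be the first one. The suffix from \<open>b\<close> is feasible but cannot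
  tie with \<open>w\<close> in row \<open>b\<close>, so by the recurrence \<open>w\<close> has a zero there that may be raised to one.
  A competitor that leaves \<open>w\<close> before row \<open>b\<close> is larger already there. One that agrees with \<open>w\<close>
  before \<open>b\<close> must also have a one in row \<open>b\<close>, since otherwise row \<open>b\<close> could have been kept, and below
  \<open>b\<close> it contains all prescribed ones.
\<close>

lemma least_column_greedy:
  assumes feas: "feasible 1 m Z I w"
    and consistent: "\<And>r. r \<in> {1..m} \<Longrightarrow> \<not> (Z r \<and> I r)"
  shows "least_column m Z I w (greedy m Z I w)"
proof (cases "\<forall>r \<in> {1..m}. keep m Z I w r")
  case True
  then have eq: "greedy m Z I w r = w r" if "r \<in> {1..m}" for r
    using that by (auto simp: greedy_def)
  have "fits 1 m Z I w"
    using True by (auto simp: fits_def keep_def)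
  then have "least_column m Z I w w"
    by (simp add: least_column_def lex_le_refl)
  with eq show ?thesis
    using least_column_cong[of m w w "greedy m Z I w" w] by blast
next
  case False
  \<comment> \<open>The topmost row in which the bound cannot be repeated.\<close>
  define b where "b = (LEAST r. r \<in> {1..m} \<and> \<not> keep m Z I w r)"
  have b: "b \<in> {1..m}" "\<not> keep m Z I w b"
    using False LeastI_ex[of "\<lambda>r. r \<in> {1..m} \<and> \<not> keep m Z I w r"] unfolding b_def by blast+
  have before: "keep m Z I w r" if "r \<in> {1..<b}" for r
    using not_less_Least[of r "\<lambda>r. r \<in> {1..m} \<and> \<not> keep m Z I w r"] that b(1)
    unfolding b_def[symmetric] by auto
  let ?x = "greedy m Z I w"
  have x_before: "?x r = w r" if "r \<in> {1..<b}" for r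
    using that before by (auto simp: greedy_def)
  have x_b: "?x b"
    using before b by (auto simp: greedy_def)
  have x_after: "?x r = I r" if "r \<in> {Suc b..m}" for r
  proof -
    have "b \<in> {1..r}" "b \<in> {1..<r}" using that b(1) by auto
    with b(2) show ?thesis unfolding greedy_def by auto
  qed
  have "feasible b m Z I w"
  proof (cases "b = 1")
    case True
    with feas show ?thesis by simp
  next
    case False
    with b(1) have "b - 1 \<in> {1..<b}" "Suc (b - 1) = b" by auto
    with before[of "b - 1"] show ?thesis by (simp add: keep_def)
  qed
  moreover have "feasible b m Z I w \<longleftrightarrow> keep m Z I w b \<or> (\<not> w b \<and> \<not> Z b)"
    using b(1) consistent by (intro feasible_Suc) auto
  ultimately have w_b: "\<not> w b" "\<not> Z b"
    using b(2) by auto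
  have fits_x: "fits 1 m Z I ?x"
    unfolding fits_def
  proof
    fix r assume r: "r \<in> {1..m}"
    consider "r \<in> {1..<b}" | "r = b" | "r \<in> {Suc b..m}" using r by fastforce
    then show "(Z r \<longrightarrow> \<not> ?x r) \<and> (I r \<longrightarrow> ?x r)"
    proof cases
      case 1
      with before[of r] x_before[of r] show ?thesis by (auto simp: keep_def)
    next
      case 2
      with x_b w_b show ?thesis by simp
    next
      case 3
      with x_after[of r] consistent[of r] r show ?thesis by auto
    qed
  qed
  have "lex_le 1 m w ?x"
    unfolding lex_le_def using b(1) x_before x_b w_b(1) by (intro disjI2 bexI[of _ b]) auto
  moreover have "lex_le 1 m ?x y" if y: "fits 1 m Z I y" "lex_le 1 m w y" for y
  proof (cases "\<forall>r \<in> {1..<b}. w r = y r")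
    case True
    then have "lex_le b m w y"
      using lex_le_drop_prefix[of b w y m] y(2) b(1) by auto
    moreover have y_b: "y b"
    proof (rule ccontr)
      assume "\<not> y b"
      with \<open>lex_le b m w y\<close> w_b(1) b(1) have "lex_le (Suc b) m w y"
        by (auto simp: lex_le_Suc)
      moreover have "fits (Suc b) m Z I y" "\<not> I b"
        using y(1) b(1) \<open>\<not> y b\<close> by (auto simp: fits_def)
      ultimately show False
        using b(2) w_b(1) by (auto simp: keep_def feasible_def)
    qed
    have "lex_le (Suc b) m ?x y"
      using b(1) x_after y(1) by (intro lex_le_pointwise) (auto simp: fits_def)
    with y_b x_b b(1) have "lex_le b m ?x y"
      by (auto simp: lex_le_Suc)
    moreover have "\<forall>r \<in> {1..<b}. ?x r = y r"
      using True x_before by blast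
    ultimately show ?thesis
      using lex_le_drop_prefix[of b ?x y m] b(1) by auto
  next
    case False
    then obtain r0 where r0: "r0 \<in> {1..<b}" "w r0 \<noteq> y r0" by blast
    obtain r where r: "r \<in> {1..m}" "\<forall>r' \<in> {1..<r}. w r' = y r'" "\<not> w r" "y r"
    proof -
      have "r0 \<in> {1..m}" using r0(1) b(1) by auto
      with r0(2) have "\<not> (\<forall>r \<in> {1..m}. w r = y r)" by blast
      with y(2) show ?thesis using that unfolding lex_le_def by blast
    qed
    have "r \<le> r0"
      using r(2) r0 by (metis atLeastLessThan_iff not_le)
    with r0 r x_before have "(\<forall>r' \<in> {1..<r}. ?x r' = y r') \<and> \<not> ?x r \<and> y r"
      by auto
    with r(1) show ?thesis unfolding lex_le_def by blast
  qed
  ultimately show ?thesis using fits_x by (simp add: least_column_def)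
qed

section \<open>Increasing families of columns\<close>

text \<open>
  Columns are numbered in the order in which they are processed, which is an increasing order in
  both sweeps.
\<close>

definition increasing_family ::
  "nat \<Rightarrow> nat \<Rightarrow> (nat \<Rightarrow> nat \<Rightarrow> bool) \<Rightarrow> (nat \<Rightarrow> nat \<Rightarrow> bool) \<Rightarrow> (nat \<Rightarrow> nat \<Rightarrow> bool) \<Rightarrow> bool" where
  "increasing_family m n Z I Y \<longleftrightarrow>
     (\<forall>c \<in> {1..n}. fits 1 m (Z c) (I c) (Y c)) \<and> (\<forall>c \<in> {1..<n}. lex_le 1 m (Y c) (Y (Suc c)))"

text \<open>
  Column \<open>0\<close> is an artificial lower bound for the first column. Being zero, it imposes nothing.
\<close>

definition least_family ::
  "nat \<Rightarrow> nat \<Rightarrow> (nat \<Rightarrow> nat \<Rightarrow> bool) \<Rightarrow> (nat \<Rightarrow> nat \<Rightarrow> bool) \<Rightarrow> (nat \<Rightarrow> nat \<Rightarrow> bool) \<Rightarrow> bool" where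
  "least_family m n Z I X \<longleftrightarrow>
     (\<forall>r \<in> {1..m}. \<not> X 0 r) \<and>
     (\<forall>c < n. least_column m (Z (Suc c)) (I (Suc c)) (X c) (X (Suc c)))"

lemma least_family_increasing:
  assumes "least_family m n Z I X"
  shows "increasing_family m n Z I X"
proof -
  have "least_column m (Z c) (I c) (X (c - 1)) (X c)" if "c \<in> {1..n}" for c
    using assms that unfolding least_family_def by (cases c) auto
  then show ?thesis
    using assms unfolding increasing_family_def least_family_def least_column_def by simp
qed

text \<open>
  The choice that is least for each column separately is least for all columns simultaneously:
  enlarging a column could only raise the bound for the following ones.
\<close>

lemma least_family_le:
  assumes "least_family m k Z I X" "increasing_family m n Z I Y" "k \<le> n" "c \<in> {1..k}"
  shows "lex_le 1 m (X c) (Y c)"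
proof -
  have "1 \<le> c" "c \<le> k" using assms(4) by auto
  then show ?thesis
  proof (induction c rule: dec_induct)
    case base
    have "lex_le 1 m (X 0) (Y 1)"
      using assms(1) by (intro lex_le_pointwise) (auto simp: least_family_def)
    then show ?case
      using assms base by (fastforce simp: least_family_def least_column_def increasing_family_def)
  next
    case (step c)
    then have "lex_le 1 m (X c) (Y c)" by simp
    moreover have "lex_le 1 m (Y c) (Y (Suc c))"
      using assms step by (auto simp: increasing_family_def)
    ultimately have "lex_le 1 m (X c) (Y (Suc c))"
      by (rule lex_le_trans) simp
    moreover have "fits 1 m (Z (Suc c)) (I (Suc c)) (Y (Suc c))"
      using assms step by (auto simp: increasing_family_def)
    moreover have "least_column m (Z (Suc c)) (I (Suc c)) (X c) (X (Suc c))"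
      using assms(1) step.prems by (simp add: least_family_def)
    ultimately show ?case by (simp add: least_column_def)
  qed
qed

text \<open>
  Read contrapositively: once no column fits above the current greedy one, no increasing family
  exists at all, so reporting emptiness at that point is correct.
\<close>

lemma feasible_next_column:
  assumes "least_family m k Z I X" "increasing_family m n Z I Y" "k < n"
  shows "feasible 1 m (Z (Suc k)) (I (Suc k)) (X k)"
proof -
  have fit: "fits 1 m (Z (Suc k)) (I (Suc k)) (Y (Suc k))"
    using assms by (auto simp: increasing_family_def)
  have "lex_le 1 m (X k) (Y (Suc k))"
  proof (cases "k = 0")
    case True
    then show ?thesis
      using assms(1) by (intro lex_le_pointwise) (auto simp: least_family_def)
  next
    case False
    then have "lex_le 1 m (X k) (Y k)" "lex_le 1 m (Y k) (Y (Suc k))"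
      using least_family_le[OF assms(1,2), of k] assms(2,3) by (auto simp: increasing_family_def)
    then show ?thesis by (rule lex_le_trans) simp
  qed
  with fit show ?thesis unfolding feasible_def by blast
qed

section \<open>Fixing sets of binary matrices\<close>

text \<open>
  Every binary point is an extreme point of the cube: an entry \<open>0\<close> or \<open>1\<close> is the minimum or the maximum
  over the cube, so both ends of a segment with \<open>p\<close> in its relative interior must share it.
\<close>

lemma convex_cube_minus_binary:
  assumes "p \<in> binary_matrices m n"
  shows "convex (cube m n - {p})"
  unfolding convex_alt
proof (intro ballI allI impI)
  fix x y :: matr and u :: real
  assume x: "x \<in> cube m n - {p}" and y: "y \<in> cube m n - {p}" and u: "0 \<le> u \<and> u \<le> 1"
  let ?z = "(1 - u) *\<^sub>R x + u *\<^sub>R y"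
  have z: "Poly_Mapping.lookup ?z q =
      (1 - u) * Poly_Mapping.lookup x q + u * Poly_Mapping.lookup y q" for q
    by (simp add: lookup_add scaleR_poly_mapping_def)
  have outside: "Poly_Mapping.lookup x q = 0" "Poly_Mapping.lookup y q = 0"
    if "q \<notin> grid m n" for q
    using x y that by (auto simp: cube_def matrices_def in_keys_iff)
  have inside: "0 \<le> Poly_Mapping.lookup x q \<and> Poly_Mapping.lookup x q \<le> 1"
      "0 \<le> Poly_Mapping.lookup y q \<and> Poly_Mapping.lookup y q \<le> 1" if "q \<in> grid m n" for q
    using x y that by (auto simp: cube_def)
  have "Poly_Mapping.lookup ?z q = 0" if "q \<notin> grid m n" for q
    unfolding z using outside[OF that] by simp
  then have "?z \<in> matrices m n"
    unfolding matrices_def in_keys_iff subset_iff mem_Collect_eq by blast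
  moreover have "0 \<le> Poly_Mapping.lookup ?z q" "Poly_Mapping.lookup ?z q \<le> 1"
    if "q \<in> grid m n" for q
    using inside[OF that] u convex_bound_le[of "Poly_Mapping.lookup x q" 1 "Poly_Mapping.lookup y q" "1 - u" u]
    by (auto simp: z)
  moreover have "?z \<noteq> p"
  proof
    assume eq: "?z = p"
    consider "u = 0" | "u = 1" | "0 < u" "u < 1" using u by linarith
    then show False
    proof cases
      case 1
      with eq x show False by simp
    next
      case 2
      with eq y show False by simp
    next
      case 3
      have "Poly_Mapping.lookup x q = Poly_Mapping.lookup p q" for q
      proof (cases "q \<in> grid m n")
        case True
        then have "Poly_Mapping.lookup p q = 0 \<or> Poly_Mapping.lookup p q = 1"
          using assms by (auto simp: binary_matrices_def)
        then show ?thesis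
        proof
          assume p0: "Poly_Mapping.lookup p q = 0"
          then have "(1 - u) * Poly_Mapping.lookup x q + u * Poly_Mapping.lookup y q = 0"
            using z[of q] eq by simp
          moreover have "0 \<le> (1 - u) * Poly_Mapping.lookup x q" "0 \<le> u * Poly_Mapping.lookup y q"
            using 3 inside[OF True] by auto
          ultimately have "(1 - u) * Poly_Mapping.lookup x q = 0" by linarith
          with 3 p0 show ?thesis by simp
        next
          assume p1: "Poly_Mapping.lookup p q = 1"
          then have "(1 - u) * (1 - Poly_Mapping.lookup x q) + u * (1 - Poly_Mapping.lookup y q) = 0"
            using z[of q] eq by (simp add: algebra_simps)
          moreover have "0 \<le> (1 - u) * (1 - Poly_Mapping.lookup x q)"
              "0 \<le> u * (1 - Poly_Mapping.lookup y q)"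
            using 3 inside[OF True] by auto
          ultimately have "(1 - u) * (1 - Poly_Mapping.lookup x q) = 0" by linarith
          with 3 p1 show ?thesis by simp
        qed
      next
        case False
        then show ?thesis
          using outside assms by (auto simp: binary_matrices_def matrices_def in_keys_iff)
      qed
      then have "x = p" by (intro poly_mapping_eqI)
      with x show False by simp
    qed
  qed
  ultimately show "?z \<in> cube m n - {p}" by (simp add: cube_def)
qed

lemma binary_subset_cube: "binary_matrices m n \<subseteq> cube m n"
  by (force simp: binary_matrices_def cube_def)

lemma convex_hull_binary:
  assumes "V \<subseteq> binary_matrices m n"
  shows "convex hull V \<inter> binary_matrices m n = V"
proof
  show "V \<subseteq> convex hull V \<inter> binary_matrices m n"
    using assms hull_subset[of V convex] by auto
  show "convex hull V \<inter> binary_matrices m n \<subseteq> V"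
  proof
    fix p assume p: "p \<in> convex hull V \<inter> binary_matrices m n"
    show "p \<in> V"
    proof (rule ccontr)
      assume "p \<notin> V"
      then have "V \<subseteq> cube m n - {p}"
        using assms binary_subset_cube by auto
      then have "convex hull V \<subseteq> cube m n - {p}"
        using p by (intro hull_minimal convex_cube_minus_binary) auto
      with p show False by auto
    qed
  qed
qed

definition constant_entries :: "nat \<Rightarrow> nat \<Rightarrow> matr set \<Rightarrow> real \<Rightarrow> (nat \<times> nat) set" where
  "constant_entries m n V a = {p \<in> grid m n. \<forall>X \<in> V. Poly_Mapping.lookup X p = a}"

text \<open>
  A face contains \<open>V\<close> iff its prescriptions are shared by all members of \<open>V\<close>, and more prescriptions
  give a smaller face.
\<close>

lemma smallest_face_nonempty:
  assumes "V \<subseteq> binary_matrices m n" "V \<noteq> {}"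
  shows "index_sets m n (constant_entries m n V 0) (constant_entries m n V 1)"
    and "\<Inter> {G \<in> cube_faces m n. V \<subseteq> G} = face m n (constant_entries m n V 0) (constant_entries m n V 1)"
proof -
  let ?J = "face m n (constant_entries m n V 0) (constant_entries m n V 1)"
  show idx: "index_sets m n (constant_entries m n V 0) (constant_entries m n V 1)"
    using assms(2) by (fastforce simp: index_sets_def constant_entries_def)
  have "V \<subseteq> ?J"
    using assms(1) binary_subset_cube[of m n] by (auto simp: face_def constant_entries_def)
  with idx have "?J \<in> {G \<in> cube_faces m n. V \<subseteq> G}"
    by (auto simp: cube_faces_def)
  moreover have "?J \<subseteq> G" if "G \<in> cube_faces m n" "V \<subseteq> G" for G
  proof -
    have "G \<noteq> {}" using that(2) assms(2) by auto
    with that(1) obtain K0 K1 where G: "G = face m n K0 K1" "index_sets m n K0 K1"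
      by (auto simp: cube_faces_def)
    then have "K0 \<subseteq> constant_entries m n V 0" "K1 \<subseteq> constant_entries m n V 1"
      using that(2) unfolding face_def constant_entries_def index_sets_def by blast+
    with G show ?thesis by (auto simp: face_def)
  qed
  ultimately show "\<Inter> {G \<in> cube_faces m n. V \<subseteq> G} = ?J" by blast
qed

text \<open>
  The empty set counts as a face of the cube, hence the intersection is empty for \<open>V = {}\<close>.
\<close>

lemma smallest_face_empty_iff:
  assumes "V \<subseteq> binary_matrices m n"
  shows "\<Inter> {G \<in> cube_faces m n. V \<subseteq> G} = {} \<longleftrightarrow> V = {}"
proof
  assume "V = {}"
  then have "{} \<in> {G \<in> cube_faces m n. V \<subseteq> G}" by (simp add: cube_faces_def)
  then show "\<Inter> {G \<in> cube_faces m n. V \<subseteq> G} = {}" by blast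
next
  assume "\<Inter> {G \<in> cube_faces m n. V \<subseteq> G} = {}"
  then show "V = {}" by blast
qed

definition matr_of :: "nat \<Rightarrow> nat \<Rightarrow> (nat \<Rightarrow> nat \<Rightarrow> bool) \<Rightarrow> matr" where
  "matr_of m n Y =
     Abs_poly_mapping (\<lambda>p. if p \<in> grid m n \<and> Y (snd p) (fst p) then 1 else 0)"

text \<open>
  Matrices of truth values are indexed column first, so that \<open>bits X j\<close> is a column.
\<close>

definition bits :: "matr \<Rightarrow> nat \<Rightarrow> nat \<Rightarrow> bool" where
  "bits X j i \<longleftrightarrow> Poly_Mapping.lookup X (i, j) = 1"

definition solutions :: "nat \<Rightarrow> nat \<Rightarrow> (nat \<times> nat) set \<Rightarrow> (nat \<times> nat) set \<Rightarrow> (nat \<Rightarrow> nat \<Rightarrow> bool) set" where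
  "solutions m n I0 I1 =
     {Y. (\<forall>j \<in> {1..n}. fits 1 m (\<lambda>i. (i, j) \<in> I0) (\<lambda>i. (i, j) \<in> I1) (Y j)) \<and>
         (\<forall>j \<in> {1..<n}. lex_le 1 m (Y (Suc j)) (Y j))}"

lemma lookup_matr_of:
  "Poly_Mapping.lookup (matr_of m n Y) p = (if p \<in> grid m n \<and> Y (snd p) (fst p) then 1 else 0)"
proof -
  have "finite (grid m n)" by (simp add: grid_def)
  then have "finite {p. (if p \<in> grid m n \<and> Y (snd p) (fst p) then 1 else 0) \<noteq> (0 :: real)}"
    by (rule rev_finite_subset) auto
  then show ?thesis unfolding matr_of_def by (subst lookup_Abs_poly_mapping) auto
qed

lemma matr_of_binary: "matr_of m n Y \<in> binary_matrices m n"
  by (auto simp: binary_matrices_def matrices_def in_keys_iff lookup_matr_of split: if_splits)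

lemma bits_matr_of: "(i, j) \<in> grid m n \<Longrightarrow> bits (matr_of m n Y) j i = Y j i"
  by (simp add: bits_def lookup_matr_of)

lemma lex_geq_iff_lex_le:
  assumes X: "X \<in> binary_matrices m n" and "j \<in> {1..n}" "k \<in> {1..n}"
  shows "lex_geq m (column X j) (column X k) \<longleftrightarrow> lex_le 1 m (bits X k) (bits X j)"
proof -
  have entry: "Poly_Mapping.lookup X (r, l) = of_bool (bits X l r)"
    if "r \<in> {1..m}" "l \<in> {1..n}" for r l
  proof -
    have "Poly_Mapping.lookup X (r, l) \<in> {0, 1}"
      using X that unfolding binary_matrices_def grid_def by blast
    then show ?thesis by (auto simp: bits_def)
  qed
  have eq: "column X j r = column X k r \<longleftrightarrow> bits X k r = bits X j r" if "r \<in> {1..m}" for r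
    using that assms(2,3) by (auto simp: column_def entry)
  have "lex_greater m (column X j) (column X k) \<longleftrightarrow>
      (\<exists>r \<in> {1..m}. (\<forall>r' \<in> {1..<r}. bits X k r' = bits X j r') \<and> \<not> bits X k r \<and> bits X j r)"
    unfolding lex_greater_def
  proof (rule bex_cong[OF refl])
    fix r assume r: "r \<in> {1..m}"
    then have "(\<forall>r' \<in> {1..<r}. column X j r' = column X k r') \<longleftrightarrow>
        (\<forall>r' \<in> {1..<r}. bits X k r' = bits X j r')"
      using eq by (intro ball_cong) auto
    moreover have "column X j r = 1 \<and> column X k r = 0 \<longleftrightarrow> \<not> bits X k r \<and> bits X j r"
      using entry[OF r] assms(2,3) by (auto simp: column_def)
    ultimately show "((\<forall>r' \<in> {1..<r}. column X j r' = column X k r') \<and> column X j r = 1 \<and> column X k r = 0) \<longleftrightarrow>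
        ((\<forall>r' \<in> {1..<r}. bits X k r' = bits X j r') \<and> \<not> bits X k r \<and> bits X j r)"
      by blast
  qed
  then show ?thesis unfolding lex_geq_def lex_le_def using eq by auto
qed

lemma solutions_cong:
  assumes "\<And>i j. (i, j) \<in> grid m n \<Longrightarrow> Y j i = Y' j i"
  shows "Y \<in> solutions m n I0 I1 \<longleftrightarrow> Y' \<in> solutions m n I0 I1"
proof -
  have "fits 1 m Z I (Y j) = fits 1 m Z I (Y' j)" if "j \<in> {1..n}" for j Z I
    using assms that by (intro fits_cong) (auto simp: grid_def)
  moreover have "lex_le 1 m (Y (Suc j)) (Y j) = lex_le 1 m (Y' (Suc j)) (Y' j)"
    if "j \<in> {1..<n}" for j
    using assms that by (intro lex_le_cong) (auto simp: grid_def)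
  ultimately show ?thesis by (simp add: solutions_def)
qed

text \<open>
  Taking the convex hull adds no new binary matrices, so the orbitope may be replaced by its
  generators, and the face contributes only its prescriptions.
\<close>

lemma vertices_in_face:
  assumes "index_sets m n I0 I1"
  shows "full_orbitope m n \<inter> face m n I0 I1 \<inter> binary_matrices m n =
    {X \<in> binary_matrices m n. bits X \<in> solutions m n I0 I1}"
proof -
  let ?V = "{X \<in> binary_matrices m n. \<forall>j \<in> {1..<n}. lex_geq m (column X j) (column X (j + 1))}"
  have "full_orbitope m n \<inter> binary_matrices m n = ?V"
    unfolding full_orbitope_def by (rule convex_hull_binary) auto
  then have "full_orbitope m n \<inter> face m n I0 I1 \<inter> binary_matrices m n = ?V \<inter> face m n I0 I1"
    by blast
  also have "\<dots> = {X \<in> binary_matrices m n. bits X \<in> solutions m n I0 I1}"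
  proof -
    have "X \<in> ?V \<inter> face m n I0 I1 \<longleftrightarrow> bits X \<in> solutions m n I0 I1"
      if X: "X \<in> binary_matrices m n" for X
    proof -
      have sub: "I0 \<subseteq> grid m n" "I1 \<subseteq> grid m n" using assms by (auto simp: index_sets_def)
      have "X \<in> face m n I0 I1 \<longleftrightarrow>
          (\<forall>p \<in> I0. Poly_Mapping.lookup X p = 0) \<and> (\<forall>p \<in> I1. Poly_Mapping.lookup X p = 1)"
        using X binary_subset_cube by (auto simp: face_def)
      also have "\<dots> \<longleftrightarrow> (\<forall>(i, j) \<in> I0. \<not> bits X j i) \<and> (\<forall>(i, j) \<in> I1. bits X j i)"
        using X sub by (fastforce simp: bits_def binary_matrices_def)
      also have "\<dots> \<longleftrightarrow>
          (\<forall>j \<in> {1..n}. fits 1 m (\<lambda>i. (i, j) \<in> I0) (\<lambda>i. (i, j) \<in> I1) (bits X j))"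
        using sub unfolding fits_def grid_def by fastforce
      finally have face: "X \<in> face m n I0 I1 \<longleftrightarrow> \<dots>" .
      have "lex_geq m (column X j) (column X (j + 1)) \<longleftrightarrow> lex_le 1 m (bits X (Suc j)) (bits X j)"
        if "j \<in> {1..<n}" for j
        using lex_geq_iff_lex_le[OF X, of j "j + 1"] that by simp
      with X face show ?thesis by (auto simp: solutions_def)
    qed
    then show ?thesis by blast
  qed
  finally show ?thesis .
qed

lemma bits_matr_of_solution:
  assumes "Y \<in> solutions m n I0 I1"
  shows "bits (matr_of m n Y) \<in> solutions m n I0 I1"
proof -
  have "Y \<in> solutions m n I0 I1 \<longleftrightarrow> bits (matr_of m n Y) \<in> solutions m n I0 I1"
    by (rule solutions_cong) (simp add: bits_matr_of)
  with assms show ?thesis by simp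
qed

lemma Fix_full_orbitope_empty_iff:
  assumes "index_sets m n I0 I1"
  shows "Fix m n (face m n I0 I1) (full_orbitope m n) = {} \<longleftrightarrow> solutions m n I0 I1 = {}"
proof -
  have "{X \<in> binary_matrices m n. bits X \<in> solutions m n I0 I1} = {} \<longleftrightarrow> solutions m n I0 I1 = {}"
    using matr_of_binary bits_matr_of_solution by blast
  then show ?thesis
    unfolding Fix_def vertices_in_face[OF assms] by (subst smallest_face_empty_iff) auto
qed

definition common :: "nat \<Rightarrow> nat \<Rightarrow> (nat \<times> nat) set \<Rightarrow> (nat \<times> nat) set \<Rightarrow> bool \<Rightarrow> (nat \<times> nat) set" where
  "common m n I0 I1 b = {(i, j) \<in> grid m n. \<forall>Y \<in> solutions m n I0 I1. Y j i = b}"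

lemma Fix_full_orbitope_nonempty:
  assumes "index_sets m n I0 I1" and nonempty: "solutions m n I0 I1 \<noteq> {}"
  shows "index_sets m n (common m n I0 I1 False) (common m n I0 I1 True)"
    and "Fix m n (face m n I0 I1) (full_orbitope m n) =
      face m n (common m n I0 I1 False) (common m n I0 I1 True)"
proof -
  let ?V = "{X \<in> binary_matrices m n. bits X \<in> solutions m n I0 I1}"
  have V: "?V \<subseteq> binary_matrices m n" by blast
  have matr_of_V: "matr_of m n Y \<in> ?V" if "Y \<in> solutions m n I0 I1" for Y
    using that matr_of_binary bits_matr_of_solution by blast
  with nonempty have V_nonempty: "?V \<noteq> {}" by blast
  have const: "constant_entries m n ?V (of_bool b) = common m n I0 I1 b" for b
  proof (rule set_eqI)
    fix p :: "nat \<times> nat"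
    obtain i j where p: "p = (i, j)" by force
    show "p \<in> constant_entries m n ?V (of_bool b) \<longleftrightarrow> p \<in> common m n I0 I1 b"
    proof (cases "p \<in> grid m n")
      case True
      have "Poly_Mapping.lookup X p = of_bool b \<longleftrightarrow> bits X j i = b" if "X \<in> ?V" for X
        using that True p by (auto simp: binary_matrices_def bits_def)
      then have "p \<in> constant_entries m n ?V (of_bool b) \<longleftrightarrow> (\<forall>X \<in> ?V. bits X j i = b)"
        using True by (simp add: constant_entries_def)
      also have "\<dots> \<longleftrightarrow> (\<forall>Y \<in> solutions m n I0 I1. Y j i = b)"
      proof
        assume "\<forall>X \<in> ?V. bits X j i = b"
        then have "bits (matr_of m n Y) j i = b" if "Y \<in> solutions m n I0 I1" for Y
          using matr_of_V[OF that] by blast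
        with True p show "\<forall>Y \<in> solutions m n I0 I1. Y j i = b" by (simp add: bits_matr_of)
      qed auto
      finally show ?thesis using True p by (simp add: common_def)
    next
      case False
      then show ?thesis using p by (simp add: constant_entries_def common_def)
    qed
  qed
  note face = smallest_face_nonempty[OF V V_nonempty]
  show "index_sets m n (common m n I0 I1 False) (common m n I0 I1 True)"
    using face(1) const[of False] const[of True] by simp
  show "Fix m n (face m n I0 I1) (full_orbitope m n) =
      face m n (common m n I0 I1 False) (common m n I0 I1 True)"
    unfolding Fix_def vertices_in_face[OF assms(1)]
    using face(2) const[of False] const[of True] by simp
qed

section \<open>Extreme solutions determine the fixed entries\<close>

text \<open>
  The columns of a solution decrease from left to right and hence increase when numbered from right
  to left.
\<close>

lemma solutions_iff_increasing_family:
  "Y \<in> solutions m n I0 I1 \<longleftrightarrow>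
     increasing_family m n (\<lambda>c r. (r, Suc n - c) \<in> I0) (\<lambda>c r. (r, Suc n - c) \<in> I1) (\<lambda>c. Y (Suc n - c))"
proof -
  have "{1..n} = (\<lambda>c. Suc n - c) ` {1..n}"
  proof
    show "{1..n} \<subseteq> (\<lambda>c. Suc n - c) ` {1..n}"
    proof
      fix c assume "c \<in> {1..n}"
      then have "c = Suc n - (Suc n - c)" "Suc n - c \<in> {1..n}" by auto
      then show "c \<in> (\<lambda>c. Suc n - c) ` {1..n}" by (rule image_eqI)
    qed
  qed auto
  then have all: "(\<forall>j \<in> {1..n}. P j) \<longleftrightarrow> (\<forall>c \<in> {1..n}. P (Suc n - c))" for P
    by (metis (no_types, lifting) image_iff)
  have "{1..<n} = (\<lambda>c. n - c) ` {1..<n}"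
  proof
    show "{1..<n} \<subseteq> (\<lambda>c. n - c) ` {1..<n}"
    proof
      fix c assume "c \<in> {1..<n}"
      then have "c = n - (n - c)" "n - c \<in> {1..<n}" by auto
      then show "c \<in> (\<lambda>c. n - c) ` {1..<n}" by (rule image_eqI)
    qed
  qed auto
  then have "(\<forall>j \<in> {1..<n}. P j) \<longleftrightarrow> (\<forall>c \<in> {1..<n}. P (n - c))" for P
    by (metis (no_types, lifting) image_iff)
  then have "(\<forall>j \<in> {1..<n}. lex_le 1 m (Y (Suc j)) (Y j)) \<longleftrightarrow>
      (\<forall>c \<in> {1..<n}. lex_le 1 m (Y (Suc (n - c))) (Y (n - c)))" .
  also have "\<dots> \<longleftrightarrow> (\<forall>c \<in> {1..<n}. lex_le 1 m (Y (Suc n - c)) (Y (Suc n - Suc c)))"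
    by (intro ball_cong) (auto simp: Suc_diff_le)
  finally show ?thesis
    unfolding solutions_def increasing_family_def mem_Collect_eq
    using all[of "\<lambda>j. fits 1 m (\<lambda>i. (i, j) \<in> I0) (\<lambda>i. (i, j) \<in> I1) (Y j)"] by blast
qed

text \<open>
  Complementing reverses the lexicographic order and exchanges prescribed zeros and ones. This
  reduces greatest columns to least ones.
\<close>

lemma solutions_iff_increasing_complement:
  "Y \<in> solutions m n I0 I1 \<longleftrightarrow>
     increasing_family m n (\<lambda>c r. (r, c) \<in> I1) (\<lambda>c r. (r, c) \<in> I0) (\<lambda>c r. \<not> Y c r)"
proof -
  have "fits 1 m (\<lambda>r. (r, c) \<in> I1) (\<lambda>r. (r, c) \<in> I0) (\<lambda>r. \<not> Y c r) \<longleftrightarrow>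
      fits 1 m (\<lambda>r. (r, c) \<in> I0) (\<lambda>r. (r, c) \<in> I1) (Y c)" for c
    by (auto simp: fits_def)
  then show ?thesis
    by (simp add: solutions_def increasing_family_def lex_le_complement)
qed

text \<open>
  The only new adjacencies are \<open>hi (j - 1), x\<close> and \<open>x, lo (j + 1)\<close>, and they are ordered because
  \<open>x\<close> lies below \<open>hi j\<close> and above \<open>lo j\<close>.
\<close>

lemma solution_splice:
  assumes hi: "hi \<in> solutions m n I0 I1" and lo: "lo \<in> solutions m n I0 I1"
    and fits: "fits 1 m (\<lambda>i. (i, j) \<in> I0) (\<lambda>i. (i, j) \<in> I1) x"
    and between: "lex_le 1 m (lo j) x" "lex_le 1 m x (hi j)"
  shows "(\<lambda>k. if k < j then hi k else if k = j then x else lo k) \<in> solutions m n I0 I1"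
    (is "?Y \<in> _")
proof -
  have "fits 1 m (\<lambda>i. (i, k) \<in> I0) (\<lambda>i. (i, k) \<in> I1) (?Y k)" if "k \<in> {1..n}" for k
    using that hi lo fits by (auto simp: solutions_def)
  moreover have "lex_le 1 m (?Y (Suc k)) (?Y k)" if k: "k \<in> {1..<n}" for k
  proof -
    have steps: "lex_le 1 m (hi (Suc k)) (hi k)" "lex_le 1 m (lo (Suc k)) (lo k)"
      using k hi lo by (auto simp: solutions_def)
    consider "Suc k < j" | "Suc k = j" | "k = j" | "k > j" by linarith
    then show ?thesis
    proof cases
      case 2
      then show ?thesis using steps between(2) lex_le_trans[of 1 m x "hi j" "hi k"] by auto
    next
      case 3
      then show ?thesis using steps between(1) lex_le_trans[of 1 m "lo (Suc k)" "lo j" x] by auto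
    qed (use steps in auto)
  qed
  ultimately show ?thesis by (simp add: solutions_def)
qed

text \<open>
  While \<open>lo j\<close> and \<open>hi j\<close> agree, everything between them agrees with both. From their first
  difference \<open>d\<close> on, an entry is common to all solutions only if it is prescribed: at \<open>d\<close> the two
  extremes take both values, and below \<open>d\<close> an unprescribed entry can be changed without crossing
  an extreme, because row \<open>d\<close> keeps the comparison with the opposite extreme strict.
\<close>

lemma common_value_iff:
  assumes "index_sets m n I0 I1"
    and lo: "lo \<in> solutions m n I0 I1" and hi: "hi \<in> solutions m n I0 I1"
    and bounds: "\<And>Y. Y \<in> solutions m n I0 I1 \<Longrightarrow> lex_le 1 m (lo j) (Y j) \<and> lex_le 1 m (Y j) (hi j)"
    and i: "i \<in> {1..m}" and j: "j \<in> {1..n}"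
  shows "(\<forall>Y \<in> solutions m n I0 I1. Y j i = b) \<longleftrightarrow>
     (if \<forall>r \<in> {1..i}. lo j r = hi j r then lo j i = b else (i, j) \<in> (if b then I1 else I0))"
proof (cases "\<forall>r \<in> {1..i}. lo j r = hi j r")
  case True
  have "Y j i = lo j i" if Y: "Y \<in> solutions m n I0 I1" for Y
  proof (rule lex_le_sandwich)
    show "lex_le 1 m (lo j) (Y j)" "lex_le 1 m (Y j) (hi j)" using bounds[OF Y] by blast+
    show "\<forall>r \<in> {1..i}. lo j r = hi j r" by (fact True)
    show "i \<le> m" "i \<in> {1..i}" using i by auto
  qed
  then have "(\<forall>Y \<in> solutions m n I0 I1. Y j i = b) \<longleftrightarrow> lo j i = b"
    using lo by blast
  with True show ?thesis by presburger
next
  case False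
  let ?S = "solutions m n I0 I1"
  let ?fits = "fits 1 m (\<lambda>i. (i, j) \<in> I0) (\<lambda>i. (i, j) \<in> I1)"
  have fits: "?fits (lo j)" "?fits (hi j)" using lo hi j by (auto simp: solutions_def)
  from False obtain q where q: "q \<in> {1..i}" "lo j q \<noteq> hi j q" by blast
  obtain d where d: "d \<in> {1..m}" "\<forall>r \<in> {1..<d}. lo j r = hi j r" "\<not> lo j d" "hi j d"
  proof -
    have "q \<in> {1..m}" using q(1) i by auto
    with q(2) have "\<not> (\<forall>r \<in> {1..m}. lo j r = hi j r)" by blast
    with bounds[OF lo] show ?thesis using that unfolding lex_le_def by blast
  qed
  have "d \<le> i"
  proof (rule ccontr)
    assume "\<not> d \<le> i"
    with q(1) have "q \<in> {1..<d}" by auto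
    with d(2) q(2) show False by blast
  qed
  have attained: "\<exists>Y \<in> ?S. Y j i = v" if free: "(i, j) \<notin> (if v then I0 else I1)" for v
  proof -
    \<comment> \<open>Only the case where neither extreme takes the value \<open>v\<close> in row \<open>i\<close> needs a new column.\<close>
    consider "lo j i = v" | "hi j i = v" | "lo j i \<noteq> v" "hi j i \<noteq> v" by blast
    then show ?thesis
    proof cases
      case 3
      then have "d < i" using d(3,4) \<open>d \<le> i\<close> by (cases "d = i") auto
      \<comment> \<open>Raising an entry can only increase \<open>lo j\<close>, lowering one can only decrease \<open>hi j\<close>.\<close>
      define x where "x = (if v then (lo j)(i := True) else (hi j)(i := False))"
      have "?fits x"
        using fits free by (auto simp: x_def fits_def)
      moreover have "lex_le 1 m (lo j) x \<and> lex_le 1 m x (hi j)"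
      proof (cases v)
        case True
        have "lex_le 1 m (lo j) x"
          using True by (intro lex_le_pointwise) (auto simp: x_def)
        moreover have "lex_le 1 m x (hi j)"
          unfolding lex_le_def using d \<open>d < i\<close> True
          by (intro disjI2 bexI[of _ d]) (auto simp: x_def)
        ultimately show ?thesis ..
      next
        case False
        have "lex_le 1 m x (hi j)"
          using False by (intro lex_le_pointwise) (auto simp: x_def split: if_splits)
        moreover have "lex_le 1 m (lo j) x"
          unfolding lex_le_def using d \<open>d < i\<close> False
          by (intro disjI2 bexI[of _ d]) (auto simp: x_def)
        ultimately show ?thesis by simp
      qed
      ultimately have splice: "(\<lambda>k. if k < j then hi k else if k = j then x else lo k) \<in> ?S"
        using solution_splice[OF hi lo] by blast
      have "x i = v" by (simp add: x_def)
      then show ?thesis by (intro bexI[OF _ splice]) simp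
    qed (use lo hi in auto)
  qed
  have "(i, j) \<in> (if b then I1 else I0) \<Longrightarrow> Y \<in> ?S \<Longrightarrow> Y j i = b" for Y
    using i j by (auto simp: solutions_def fits_def split: if_splits)
  moreover have "(\<forall>Y \<in> ?S. Y j i = b) \<Longrightarrow> (i, j) \<in> (if b then I1 else I0)"
    using attained[of "\<not> b"] by (cases b) auto
  ultimately have "(\<forall>Y \<in> ?S. Y j i = b) \<longleftrightarrow> (i, j) \<in> (if b then I1 else I0)" by blast
  then show ?thesis unfolding if_not_P[OF False] .
qed

section \<open>Time-bounded execution\<close>

definition runs :: "com \<Rightarrow> state \<Rightarrow> nat \<Rightarrow> (state \<Rightarrow> bool) \<Rightarrow> bool" where
  "runs c s B Q \<longleftrightarrow> (\<exists>t s'. exec c s t s' \<and> t \<le> B \<and> Q s')"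

lemma runs_weaken:
  assumes "runs c s B Q" "B \<le> B'" "\<And>s'. Q s' \<Longrightarrow> Q' s'"
  shows "runs c s B' Q'"
  using assms unfolding runs_def by (meson le_trans)

lemma runs_Seq:
  assumes "runs c1 s B1 R" "\<And>s'. R s' \<Longrightarrow> runs c2 s' B2 Q"
  shows "runs (Seq c1 c2) s (B1 + B2) Q"
  using assms unfolding runs_def by (meson add_mono exec.Seq)

text \<open>
  \<open>P k\<close> carries the number of completed iterations, so that it serves both as loop
  invariant and as termination measure. The final test of the loop condition accounts for the
  summand outside the product.
\<close>

lemma runs_While:
  assumes init: "P 0 s"
    and step: "\<And>k s. k < N \<Longrightarrow> P k s \<Longrightarrow> bval b s \<and> runs c s B (P (Suc k))"
    and stop: "\<And>s. P N s \<Longrightarrow> \<not> bval b s"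
  shows "runs (While b c) s (N * (1 + bcost b + B) + (1 + bcost b)) (P N)"
proof -
  have "runs (While b c) s ((N - k) * (1 + bcost b + B) + (1 + bcost b)) (P N)"
    if "k \<le> N" "P k s" for k s
    using that
  proof (induction arbitrary: s rule: inc_induct)
    case base
    then show ?case using stop exec.WhileFalse unfolding runs_def by fastforce
  next
    case (step k)
    from assms(2)[OF step.hyps(2) step.prems] obtain t1 s1 where
      1: "bval b s" "exec c s t1 s1" "t1 \<le> B" "P (Suc k) s1"
      unfolding runs_def by blast
    from step.IH[OF 1(4)] obtain t2 s2 where
      2: "exec (While b c) s1 t2 s2" "P N s2"
        "t2 \<le> (N - Suc k) * (1 + bcost b + B) + (1 + bcost b)"
      unfolding runs_def by blast
    have "N - k = Suc (N - Suc k)" using step.hyps(2) by simp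
    then have "1 + bcost b + t1 + t2 \<le> (N - k) * (1 + bcost b + B) + (1 + bcost b)"
      using 1(3) 2(3) by simp
    with exec.WhileTrue[OF 1(1,2) 2(1)] 2(2) show ?case unfolding runs_def by blast
  qed
  from this[of 0 s] init show ?thesis by simp
qed

primrec straight_line :: "com \<Rightarrow> bool" where
  "straight_line Skip \<longleftrightarrow> True"
| "straight_line (SetReg x a) \<longleftrightarrow> True"
| "straight_line (SetEntry A a b c) \<longleftrightarrow> True"
| "straight_line (Seq c1 c2) \<longleftrightarrow> straight_line c1 \<and> straight_line c2"
| "straight_line (Cond b c1 c2) \<longleftrightarrow> straight_line c1 \<and> straight_line c2"
| "straight_line (While b c) \<longleftrightarrow> False"

text \<open>
  Straight-line code needs no derivations of \<open>exec\<close>: its final state is computed by a function, so loop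
  bodies are verified by simplification. The clause for loops is a dummy value.
\<close>

primrec effect :: "com \<Rightarrow> state \<Rightarrow> state" where
  "effect Skip s = s"
| "effect (SetReg x a) s = set_reg x (aval a s) s"
| "effect (SetEntry A a b c) s = set_entry A (aval a s) (aval b s) (aval c s) s"
| "effect (Seq c1 c2) s = effect c2 (effect c1 s)"
| "effect (Cond b c1 c2) s = (if bval b s then effect c1 s else effect c2 s)"
| "effect (While b c) s = s"

text \<open>
  Both branches of a conditional are charged, so that the bound does not depend on the state. The
  clause for loops is a dummy value here, too.
\<close>

primrec cost_bound :: "com \<Rightarrow> nat" where
  "cost_bound Skip = 1"
| "cost_bound (SetReg x a) = 1 + acost a"
| "cost_bound (SetEntry A a b c) = 1 + acost a + acost b + acost c"
| "cost_bound (Seq c1 c2) = cost_bound c1 + cost_bound c2"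
| "cost_bound (Cond b c1 c2) = 1 + bcost b + (cost_bound c1 + cost_bound c2)"
| "cost_bound (While b c) = 0"

lemma exec_straight_line:
  "straight_line c \<Longrightarrow> \<exists>t \<le> cost_bound c. exec c s t (effect c s)"
proof (induction c arbitrary: s)
  case (Seq c1 c2)
  then obtain t1 t2 where "t1 \<le> cost_bound c1" "exec c1 s t1 (effect c1 s)"
    "t2 \<le> cost_bound c2" "exec c2 (effect c1 s) t2 (effect c2 (effect c1 s))"
    by (metis straight_line.simps(4))
  then show ?case by (intro exI[of _ "t1 + t2"]) (auto intro: exec.Seq)
next
  case (Cond b c1 c2)
  then obtain t1 t2 where t: "t1 \<le> cost_bound c1" "exec c1 s t1 (effect c1 s)"
    "t2 \<le> cost_bound c2" "exec c2 s t2 (effect c2 s)"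
    by (metis straight_line.simps(5))
  show ?case
  proof (cases "bval b s")
    case True
    with t show ?thesis by (intro exI[of _ "1 + bcost b + t1"]) (auto intro: exec.CondTrue[simplified])
  next
    case False
    with t show ?thesis by (intro exI[of _ "1 + bcost b + t2"]) (auto intro: exec.CondFalse[simplified])
  qed
qed (auto intro: exec.Skip[simplified] exec.SetReg[simplified] exec.SetEntry[simplified])

lemma runs_straight_line:
  assumes "straight_line c" "cost_bound c \<le> B" "Q (effect c s)"
  shows "runs c s B Q"
  using exec_straight_line[OF assms(1), of s] assms(2,3) unfolding runs_def by (meson le_trans)

lemma reg_set_reg [simp]: "reg (set_reg x v s) = (reg s)(x := v)"
  by (simp add: set_reg_def)

lemma arr_set_reg [simp]: "arr (set_reg x v s) = arr s"
  by (simp add: set_reg_def)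

lemma reg_set_entry [simp]: "reg (set_entry A i j v s) = reg s"
  by (simp add: set_entry_def)

lemma arr_set_entry [simp]:
  "arr (set_entry A i j v s) B k l = (if B = A \<and> k = i \<and> l = j then v else arr s B k l)"
  by (simp add: set_entry_def)

lemma arr_set_entry_other [simp]: "B \<noteq> A \<Longrightarrow> arr (set_entry A i j v s) B = arr s B"
  by (simp add: set_entry_def)

section \<open>Computing one column\<close>

definition col :: "state \<Rightarrow> string \<Rightarrow> nat \<Rightarrow> nat \<Rightarrow> bool" where
  "col s A j = (\<lambda>r. arr s A r j = 1)"

lemma col_set_reg [simp]: "col (set_reg x v s) = col s"
  by (simp add: col_def fun_eq_iff)

abbreviation is_one :: "string \<Rightarrow> aexp \<Rightarrow> aexp \<Rightarrow> bexp" where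
  "is_one A a b \<equiv> BEq (AEntry A a b) (ANum 1)"

text \<open>
  Registers \<open>j\<close> and \<open>k\<close> hold the column to be computed and the column of the same array that bounds
  it from below. \<open>G\<close> stores the feasibility of the suffix starting at each row; only its column \<open>0\<close>
  is used.
\<close>

definition keep_test :: "string \<Rightarrow> string \<Rightarrow> string \<Rightarrow> bexp" where
  "keep_test A0 A1 M =
     BAnd (is_one ''G'' (ASucc (AReg ''i'')) (ANum 0))
      (BAnd (BNot (BAnd (is_one M (AReg ''i'') (AReg ''k'')) (is_one A0 (AReg ''i'') (AReg ''j''))))
        (BNot (BAnd (BNot (is_one M (AReg ''i'') (AReg ''k''))) (is_one A1 (AReg ''i'') (AReg ''j'')))))"

definition feasibility_step :: "string \<Rightarrow> string \<Rightarrow> string \<Rightarrow> com" where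
  "feasibility_step A0 A1 M =
     Seq (Cond (keep_test A0 A1 M)
           (SetEntry ''G'' (AReg ''i'') (ANum 0) (ANum 1))
           (Cond (BAnd (BNot (is_one M (AReg ''i'') (AReg ''k'')))
                       (BNot (is_one A0 (AReg ''i'') (AReg ''j''))))
             (SetEntry ''G'' (AReg ''i'') (ANum 0) (ANum 1))
             (SetEntry ''G'' (AReg ''i'') (ANum 0) (ANum 0))))
         (SetReg ''i'' (APred (AReg ''i'')))"

text \<open>
  Row \<open>m + 1\<close> of \<open>G\<close> stands for the empty suffix, which meets every bound.
\<close>

definition feasibility_pass :: "string \<Rightarrow> string \<Rightarrow> string \<Rightarrow> com" where
  "feasibility_pass A0 A1 M =
     Seq (Seq (SetEntry ''G'' (ASucc (AReg ''m'')) (ANum 0) (ANum 1)) (SetReg ''i'' (AReg ''m'')))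
         (While (BLess (ANum 0) (AReg ''i'')) (feasibility_step A0 A1 M))"

text \<open>
  Register \<open>t\<close> is one as long as all rows so far have been kept.
\<close>

definition greedy_step :: "string \<Rightarrow> string \<Rightarrow> string \<Rightarrow> com" where
  "greedy_step A0 A1 M =
     Seq (Cond (BEq (AReg ''t'') (ANum 1))
           (Cond (keep_test A0 A1 M)
             (SetEntry M (AReg ''i'') (AReg ''j'') (AEntry M (AReg ''i'') (AReg ''k'')))
             (Seq (SetEntry M (AReg ''i'') (AReg ''j'') (ANum 1)) (SetReg ''t'' (ANum 0))))
           (SetEntry M (AReg ''i'') (AReg ''j'') (AEntry A1 (AReg ''i'') (AReg ''j''))))
         (SetReg ''i'' (ASucc (AReg ''i'')))"

definition greedy_pass :: "string \<Rightarrow> string \<Rightarrow> string \<Rightarrow> com" where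
  "greedy_pass A0 A1 M =
     Seq (Seq (SetReg ''t'' (ANum 1)) (SetReg ''i'' (ANum 1)))
         (While (BLess (AReg ''i'') (ASucc (AReg ''m''))) (greedy_step A0 A1 M))"

text \<open>
  If no column fits, the column written is meaningless and only the flag \<open>empty\<close> matters. Continuing
  instead of stopping makes the number of iterations independent of the data.
\<close>

definition column_prog :: "string \<Rightarrow> string \<Rightarrow> string \<Rightarrow> com" where
  "column_prog A0 A1 M =
     Seq (feasibility_pass A0 A1 M)
      (Seq (greedy_pass A0 A1 M)
        (Cond (is_one ''G'' (ANum 1) (ANum 0)) Skip (SetReg ''empty'' (ANum 1))))"

definition frame :: "state \<Rightarrow> string set \<Rightarrow> string set \<Rightarrow> state \<Rightarrow> bool" where
  "frame s X A s' \<longleftrightarrow> (\<forall>x. x \<notin> X \<longrightarrow> reg s' x = reg s x) \<and> (\<forall>B. B \<notin> A \<longrightarrow> arr s' B = arr s B)"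

lemma frame_reg: "frame s X A s' \<Longrightarrow> x \<notin> X \<Longrightarrow> reg s' x = reg s x"
  and frame_arr: "frame s X A s' \<Longrightarrow> B \<notin> A \<Longrightarrow> arr s' B = arr s B"
  by (auto simp: frame_def)

lemma bval_keep_test:
  assumes "arr s ''G'' (Suc i) 0 = 1 \<longleftrightarrow> feasible (Suc i) m (col s A0 j) (col s A1 j) (col s M k)"
    "reg s ''i'' = i" "reg s ''j'' = j" "reg s ''k'' = k"
  shows "bval (keep_test A0 A1 M) s \<longleftrightarrow> keep m (col s A0 j) (col s A1 j) (col s M k) i"
  using assms by (auto simp: keep_test_def keep_def col_def)

lemma feasibility_pass_correct:
  fixes s :: state
  defines "m \<equiv> reg s ''m''" and "j \<equiv> reg s ''j''" and "k \<equiv> reg s ''k''"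
  assumes distinct: "A0 \<noteq> ''G''" "A1 \<noteq> ''G''" "M \<noteq> ''G''"
    and consistent: "\<And>r. r \<in> {1..m} \<Longrightarrow> \<not> (col s A0 j r \<and> col s A1 j r)"
  shows "runs (feasibility_pass A0 A1 M) s (m * 100 + 20)
    (\<lambda>s'. frame s {''i''} {''G''} s' \<and>
       (\<forall>r \<in> {1..Suc m}. arr s' ''G'' r 0 = 1 \<longleftrightarrow>
          feasible r m (col s A0 j) (col s A1 j) (col s M k)))"
proof -
  let ?feas = "\<lambda>r. feasible r m (col s A0 j) (col s A1 j) (col s M k)"
  define P where "P = (\<lambda>l s'. frame s {''i''} {''G''} s' \<and> reg s' ''i'' = m - l \<and>
    (\<forall>r \<in> {Suc (m - l)..Suc m}. arr s' ''G'' r 0 = 1 \<longleftrightarrow> ?feas r))"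
  have init: "runs (Seq (SetEntry ''G'' (ASucc (AReg ''m'')) (ANum 0) (ANum 1)) (SetReg ''i'' (AReg ''m'')))
      s 10 (P 0)"
    by (rule runs_straight_line)
      (auto simp: P_def frame_def m_def[symmetric] feasible_past_end)
  have step: "bval (BLess (ANum 0) (AReg ''i'')) s' \<and>
      runs (feasibility_step A0 A1 M) s' 90 (P (Suc l))" if l: "l < m" and P: "P l s'" for l s'
  proof -
    define i where "i = m - l"
    have i: "1 \<le> i" "i \<le> m" "m - Suc l = i - 1" using l by (auto simp: i_def)
    have fr: "frame s {''i''} {''G''} s'" and ri: "reg s' ''i'' = i"
      and G: "\<And>r. r \<in> {Suc i..Suc m} \<Longrightarrow> arr s' ''G'' r 0 = 1 \<longleftrightarrow> ?feas r"
      using P by (auto simp: P_def i_def)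
    have regs: "reg s' ''j'' = j" "reg s' ''k'' = k"
      using frame_reg[OF fr] by (auto simp: j_def k_def)
    have arrs: "arr s' A0 = arr s A0" "arr s' A1 = arr s A1" "arr s' M = arr s M"
      using frame_arr[OF fr] distinct by auto
    then have cols: "col s' A0 = col s A0" "col s' A1 = col s A1" "col s' M = col s M"
      by (auto simp: col_def)
    have keep: "bval (keep_test A0 A1 M) s' \<longleftrightarrow> keep m (col s A0 j) (col s A1 j) (col s M k) i"
      using bval_keep_test[of s' i m A0 j A1 M k] G[of "Suc i"] i ri regs cols by auto
    have feas: "?feas i \<longleftrightarrow> bval (keep_test A0 A1 M) s' \<or>
        (arr s M i k \<noteq> 1 \<and> arr s A0 i j \<noteq> 1)"
      unfolding keep using i consistent by (subst feasible_Suc) (auto simp: col_def)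
    have "runs (feasibility_step A0 A1 M) s' 90 (P (Suc l))"
    proof (rule runs_straight_line)
      show "straight_line (feasibility_step A0 A1 M)" by (simp add: feasibility_step_def)
      show "cost_bound (feasibility_step A0 A1 M) \<le> 90"
        by (simp add: feasibility_step_def keep_test_def)
      let ?s = "effect (feasibility_step A0 A1 M) s'"
      have "frame s {''i''} {''G''} ?s"
        using fr by (auto simp: frame_def feasibility_step_def)
      moreover have "reg ?s ''i'' = i - 1"
        by (simp add: feasibility_step_def ri)
      moreover have "arr ?s ''G'' i 0 = 1 \<longleftrightarrow> ?feas i"
        unfolding feas by (auto simp: feasibility_step_def ri regs arrs)
      moreover have "arr ?s ''G'' r 0 = arr s' ''G'' r 0" if "r \<noteq> i" for r
        using that by (auto simp: feasibility_step_def ri)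
      ultimately show "P (Suc l) ?s"
        unfolding P_def i(3) using G i(1)
        by (metis Suc_pred' Suc_leI atLeastAtMost_iff le_neq_implies_less One_nat_def Suc_le_eq)
    qed
    with ri i show ?thesis by simp
  qed
  have stop: "\<not> bval (BLess (ANum 0) (AReg ''i'')) s'" if "P m s'" for s'
    using that by (simp add: P_def)
  have "runs (While (BLess (ANum 0) (AReg ''i'')) (feasibility_step A0 A1 M)) s'
      (m * 100 + 10) (P m)" if "P 0 s'" for s'
    by (rule runs_weaken[OF runs_While[where P=P, OF that step stop]]) auto
  from runs_Seq[OF init this] show ?thesis
    unfolding feasibility_pass_def by (rule runs_weaken) (auto simp: P_def)
qed

lemma greedy_pass_correct:
  fixes s :: state
  defines "m \<equiv> reg s ''m''" and "j \<equiv> reg s ''j''" and "k \<equiv> reg s ''k''"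
  assumes distinct: "A0 \<noteq> M" "A1 \<noteq> M" "M \<noteq> ''G''" and "j \<noteq> k"
    and G: "\<forall>r \<in> {1..Suc m}. arr s ''G'' r 0 = 1 \<longleftrightarrow>
      feasible r m (col s A0 j) (col s A1 j) (col s M k)"
  shows "runs (greedy_pass A0 A1 M) s (m * 100 + 20)
    (\<lambda>s'. frame s {''i'', ''t''} {M} s' \<and>
       (\<forall>r c. c \<noteq> j \<longrightarrow> arr s' M r c = arr s M r c) \<and>
       (\<forall>r \<in> {1..m}. col s' M j r \<longleftrightarrow> greedy m (col s A0 j) (col s A1 j) (col s M k) r))"
proof -
  let ?keep = "keep m (col s A0 j) (col s A1 j) (col s M k)"
  let ?greedy = "greedy m (col s A0 j) (col s A1 j) (col s M k)"
  define P where "P = (\<lambda>l s'. frame s {''i'', ''t''} {M} s' \<and> reg s' ''i'' = Suc l \<and>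
    (reg s' ''t'' = 1 \<longleftrightarrow> (\<forall>r \<in> {1..l}. ?keep r)) \<and>
    (\<forall>r c. c \<noteq> j \<longrightarrow> arr s' M r c = arr s M r c) \<and>
    (\<forall>r \<in> {1..l}. arr s' M r j = 1 \<longleftrightarrow> ?greedy r))"
  have init: "runs (Seq (SetReg ''t'' (ANum 1)) (SetReg ''i'' (ANum 1))) s 10 (P 0)"
    by (rule runs_straight_line) (auto simp: P_def frame_def)
  have step: "bval (BLess (AReg ''i'') (ASucc (AReg ''m''))) s' \<and>
      runs (greedy_step A0 A1 M) s' 90 (P (Suc l))" if l: "l < m" and P: "P l s'" for l s'
  proof -
    define i where "i = Suc l"
    have i: "1 \<le> i" "i \<le> m" "{1..l} = {1..<i}" "{1..i} = insert i {1..l}"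
      using l by (auto simp: i_def)
    have fr: "frame s {''i'', ''t''} {M} s'" and ri: "reg s' ''i'' = i"
      and t: "reg s' ''t'' = 1 \<longleftrightarrow> (\<forall>r \<in> {1..<i}. ?keep r)"
      and other: "\<And>r c. c \<noteq> j \<Longrightarrow> arr s' M r c = arr s M r c"
      and earlier: "\<And>r. r \<in> {1..l} \<Longrightarrow> arr s' M r j = 1 \<longleftrightarrow> ?greedy r"
      using P by (auto simp: P_def i_def atLeastLessThanSuc_atLeastAtMost)
    have regs: "reg s' ''j'' = j" "reg s' ''k'' = k" "reg s' ''m'' = m"
      using frame_reg[OF fr] by (auto simp: j_def k_def m_def)
    have arrs: "arr s' A0 = arr s A0" "arr s' A1 = arr s A1" "arr s' ''G'' = arr s ''G''"
      using frame_arr[OF fr] distinct by auto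
    have cols: "col s' A0 j = col s A0 j" "col s' A1 j = col s A1 j" "col s' M k = col s M k"
      using arrs other[of k] \<open>j \<noteq> k\<close> by (auto simp: col_def)
    have keep: "bval (keep_test A0 A1 M) s' \<longleftrightarrow> ?keep i"
      using bval_keep_test[of s' i m A0 j A1 M k] G i ri regs cols arrs by auto
    have greedy: "?greedy i \<longleftrightarrow>
        (if reg s' ''t'' = 1 then (if ?keep i then col s M k i else True) else col s A1 j i)"
      unfolding greedy_def t i(4) using i(3) by auto
    have "runs (greedy_step A0 A1 M) s' 90 (P (Suc l))"
    proof (rule runs_straight_line)
      show "straight_line (greedy_step A0 A1 M)" by (simp add: greedy_step_def)
      show "cost_bound (greedy_step A0 A1 M) \<le> 90"
        by (simp add: greedy_step_def keep_test_def)
      let ?s = "effect (greedy_step A0 A1 M) s'"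
      have "frame s {''i'', ''t''} {M} ?s"
        using fr by (auto simp: frame_def greedy_step_def)
      moreover have "reg ?s ''i'' = Suc i"
        by (simp add: greedy_step_def ri)
      moreover have "reg ?s ''t'' = 1 \<longleftrightarrow> (\<forall>r \<in> {1..i}. ?keep r)"
        unfolding i(4) i(3) using t by (auto simp: greedy_step_def keep)
      moreover have "arr ?s M r c = arr s M r c" if "c \<noteq> j" for r c
        using that other[OF that] by (auto simp: greedy_step_def regs)
      moreover have "arr ?s M i j = 1 \<longleftrightarrow> ?greedy i"
        unfolding greedy using other[of k i] \<open>j \<noteq> k\<close>
        by (auto simp: greedy_step_def keep ri regs arrs col_def)
      moreover have "arr ?s M r j = 1 \<longleftrightarrow> ?greedy r" if "r \<in> {1..l}" for r
        using that earlier[OF that] by (auto simp: greedy_step_def ri regs i_def)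
      ultimately show "P (Suc l) ?s"
        unfolding P_def i_def[symmetric] i(4) by blast
    qed
    with ri regs i show ?thesis by simp
  qed
  have stop: "\<not> bval (BLess (AReg ''i'') (ASucc (AReg ''m''))) s'" if "P m s'" for s'
    using that frame_reg[of s "{''i'', ''t''}" "{M}" s' "''m''"] by (simp add: P_def m_def)
  have "runs (While (BLess (AReg ''i'') (ASucc (AReg ''m''))) (greedy_step A0 A1 M)) s'
      (m * 100 + 10) (P m)" if "P 0 s'" for s'
    by (rule runs_weaken[OF runs_While[where P=P, OF that step stop]]) auto
  from runs_Seq[OF init this] show ?thesis
    unfolding greedy_pass_def by (rule runs_weaken) (auto simp: P_def col_def)
qed

lemma column_prog_correct:
  fixes s :: state
  defines "m \<equiv> reg s ''m''" and "j \<equiv> reg s ''j''" and "k \<equiv> reg s ''k''"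
  assumes distinct: "A0 \<notin> {M, ''G''}" "A1 \<notin> {M, ''G''}" "M \<noteq> ''G''" and "j \<noteq> k"
    and consistent: "\<And>r. r \<in> {1..m} \<Longrightarrow> \<not> (col s A0 j r \<and> col s A1 j r)"
  shows "runs (column_prog A0 A1 M) s (m * 200 + 60)
    (\<lambda>s'. frame s {''i'', ''t'', ''empty''} {M, ''G''} s' \<and>
       (\<forall>r c. c \<noteq> j \<longrightarrow> arr s' M r c = arr s M r c) \<and>
       (if feasible 1 m (col s A0 j) (col s A1 j) (col s M k)
        then reg s' ''empty'' = reg s ''empty'' \<and>
          least_column m (col s A0 j) (col s A1 j) (col s M k) (col s' M j)
        else reg s' ''empty'' = 1))"
    (is "runs _ _ _ ?Q")
proof -
  let ?feas = "\<lambda>r. feasible r m (col s A0 j) (col s A1 j) (col s M k)"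
  let ?G = "\<lambda>s'. \<forall>r \<in> {1..Suc m}. arr s' ''G'' r 0 = 1 \<longleftrightarrow> ?feas r"
  have first: "runs (feasibility_pass A0 A1 M) s (m * 100 + 20)
      (\<lambda>s1. frame s {''i''} {''G''} s1 \<and> ?G s1)"
    unfolding m_def j_def k_def
    by (rule feasibility_pass_correct) (use distinct consistent in \<open>auto simp: m_def j_def\<close>)
  have second: "runs (Seq (greedy_pass A0 A1 M)
      (Cond (is_one ''G'' (ANum 1) (ANum 0)) Skip (SetReg ''empty'' (ANum 1)))) s1
      ((m * 100 + 20) + 20) ?Q"
    if s1: "frame s {''i''} {''G''} s1 \<and> ?G s1" for s1
  proof (rule runs_Seq)
    have fr1: "frame s {''i''} {''G''} s1" using s1 by blast
    have regs: "reg s1 ''m'' = m" "reg s1 ''j'' = j" "reg s1 ''k'' = k"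
      using frame_reg[OF fr1] by (auto simp: m_def j_def k_def)
    have "arr s1 A0 = arr s A0" "arr s1 A1 = arr s A1" "arr s1 M = arr s M"
      using frame_arr[OF fr1] distinct by auto
    then have cols: "col s1 A0 = col s A0" "col s1 A1 = col s A1" "col s1 M = col s M"
        and M1: "arr s1 M = arr s M"
      by (auto simp: col_def)
    show "runs (greedy_pass A0 A1 M) s1 (m * 100 + 20)
        (\<lambda>s2. frame s1 {''i'', ''t''} {M} s2 \<and>
          (\<forall>r c. c \<noteq> j \<longrightarrow> arr s2 M r c = arr s1 M r c) \<and>
          (\<forall>r \<in> {1..m}. col s2 M j r \<longleftrightarrow> greedy m (col s A0 j) (col s A1 j) (col s M k) r))"
      using greedy_pass_correct[of A0 M A1 s1] distinct \<open>j \<noteq> k\<close> s1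
      unfolding regs cols by blast
    fix s2
    assume s2: "frame s1 {''i'', ''t''} {M} s2 \<and>
          (\<forall>r c. c \<noteq> j \<longrightarrow> arr s2 M r c = arr s1 M r c) \<and>
          (\<forall>r \<in> {1..m}. col s2 M j r \<longleftrightarrow> greedy m (col s A0 j) (col s A1 j) (col s M k) r)"
    have fr2: "frame s {''i'', ''t''} {M, ''G''} s2"
      using s2 fr1 unfolding frame_def by auto
    have G: "arr s2 ''G'' 1 0 = 1 \<longleftrightarrow> ?feas 1"
      using s1 s2 distinct(3) frame_arr[of s1 _ "{M}" s2 "''G''"] by auto
    have least: "least_column m (col s A0 j) (col s A1 j) (col s M k) (col s2 M j)" if "?feas 1"
    proof -
      have "least_column m (col s A0 j) (col s A1 j) (col s M k)
          (greedy m (col s A0 j) (col s A1 j) (col s M k))"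
        using that consistent by (rule least_column_greedy)
      then show ?thesis
        using least_column_cong[of m "col s M k" "col s M k" "col s2 M j"] s2 by blast
    qed
    show "runs (Cond (is_one ''G'' (ANum 1) (ANum 0)) Skip (SetReg ''empty'' (ANum 1))) s2 20 ?Q"
    proof (rule runs_straight_line)
      let ?s = "effect (Cond (is_one ''G'' (ANum 1) (ANum 0)) Skip (SetReg ''empty'' (ANum 1))) s2"
      have "frame s {''i'', ''t'', ''empty''} {M, ''G''} ?s"
        using fr2 by (auto simp: frame_def)
      moreover have "arr ?s = arr s2" by simp
      moreover have "col ?s = col s2" by (auto simp: col_def fun_eq_iff)
      moreover have "reg ?s ''empty'' = (if ?feas 1 then reg s ''empty'' else 1)"
        using G frame_reg[OF fr2] by auto
      moreover have "arr s2 M r c = arr s M r c" if "c \<noteq> j" for r c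
        using that s2 M1 by auto
      ultimately show "?Q ?s" using least by auto
    qed auto
  qed
  from runs_Seq[OF first second] show ?thesis
    unfolding column_prog_def by (rule runs_weaken) auto
qed

section \<open>Sweeping over all columns\<close>

definition clear_pass :: "string \<Rightarrow> com" where
  "clear_pass M =
     Seq (SetReg ''i'' (AReg ''m''))
      (While (BLess (ANum 0) (AReg ''i''))
        (Seq (SetEntry M (AReg ''i'') (AReg ''k'') (ANum 0)) (SetReg ''i'' (APred (AReg ''i'')))))"

definition sweep_step :: "string \<Rightarrow> string \<Rightarrow> string \<Rightarrow> aexp \<Rightarrow> com" where
  "sweep_step A0 A1 M advance =
     Seq (column_prog A0 A1 M)
      (Seq (SetReg ''k'' (AReg ''j''))
        (Seq (SetReg ''j'' advance) (SetReg ''c'' (APred (AReg ''c'')))))"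

text \<open>
  The order of the columns is a parameter: \<open>before\<close> is the position of the artificial zero column,
  \<open>first\<close> that of the first real one, and \<open>advance\<close> computes the next position from register \<open>j\<close>.
\<close>

definition sweep :: "string \<Rightarrow> string \<Rightarrow> string \<Rightarrow> aexp \<Rightarrow> aexp \<Rightarrow> aexp \<Rightarrow> com" where
  "sweep A0 A1 M before first advance =
     Seq (Seq (SetReg ''k'' before) (Seq (SetReg ''j'' first) (SetReg ''c'' (AReg ''n''))))
      (Seq (clear_pass M)
        (While (BLess (ANum 0) (AReg ''c'')) (sweep_step A0 A1 M advance)))"

lemma clear_pass_correct:
  fixes s :: state
  defines "m \<equiv> reg s ''m''" and "k \<equiv> reg s ''k''"
  shows "runs (clear_pass M) s (m * 20 + 20)
    (\<lambda>s'. frame s {''i''} {M} s' \<and> (\<forall>r \<in> {1..m}. \<not> col s' M k r))"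
proof -
  define P where "P = (\<lambda>l s'. frame s {''i''} {M} s' \<and> reg s' ''i'' = m - l \<and>
    (\<forall>r \<in> {Suc (m - l)..m}. arr s' M r k = 0))"
  let ?body = "Seq (SetEntry M (AReg ''i'') (AReg ''k'') (ANum 0)) (SetReg ''i'' (APred (AReg ''i'')))"
  have init: "runs (SetReg ''i'' (AReg ''m'')) s 10 (P 0)"
    by (rule runs_straight_line) (auto simp: P_def frame_def m_def)
  have step: "bval (BLess (ANum 0) (AReg ''i'')) s' \<and> runs ?body s' 10 (P (Suc l))"
    if l: "l < m" and P: "P l s'" for l s'
  proof -
    have fr: "frame s {''i''} {M} s'" and ri: "reg s' ''i'' = m - l"
      and zero: "\<And>r. r \<in> {Suc (m - l)..m} \<Longrightarrow> arr s' M r k = 0"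
      using P by (auto simp: P_def)
    have rk: "reg s' ''k'' = k" using frame_reg[OF fr] by (simp add: k_def)
    have "runs ?body s' 10 (P (Suc l))"
    proof (rule runs_straight_line)
      have "frame s {''i''} {M} (effect ?body s')"
        using fr by (auto simp: frame_def)
      moreover have "arr (effect ?body s') M r k = 0" if "r \<in> {Suc (m - Suc l)..m}" for r
        using that zero[of r] ri rk by (cases "r = m - l") auto
      ultimately show "P (Suc l) (effect ?body s')"
        by (simp add: P_def ri)
    qed auto
    with ri l show ?thesis by simp
  qed
  have stop: "\<not> bval (BLess (ANum 0) (AReg ''i'')) s'" if "P m s'" for s'
    using that by (simp add: P_def)
  have "runs (While (BLess (ANum 0) (AReg ''i'')) ?body) s' (m * 20 + 10) (P m)"
    if "P 0 s'" for s'
    by (rule runs_weaken[OF runs_While[where P=P, OF that step stop]]) auto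
  from runs_Seq[OF init this] show ?thesis
    unfolding clear_pass_def by (rule runs_weaken) (auto simp: P_def col_def)
qed

text \<open>
  \<open>\<sigma> c\<close> is the position of the column processed as number \<open>c\<close>, with the artificial column as
  number \<open>0\<close>. Injectivity ensures that a new column does not overwrite an old one.
\<close>

lemma sweep_correct:
  fixes s :: state and A0 A1 M :: string and \<sigma> :: "nat \<Rightarrow> nat"
  defines "m \<equiv> reg s ''m''" and "n \<equiv> reg s ''n''"
  defines "Z \<equiv> \<lambda>c. col s A0 (\<sigma> c)" and "I \<equiv> \<lambda>c. col s A1 (\<sigma> c)"
  assumes distinct: "A0 \<notin> {M, ''G''}" "A1 \<notin> {M, ''G''}" "M \<noteq> ''G''"
    and inj: "inj_on \<sigma> {0..n}"
    and before: "\<And>s'. reg s' ''n'' = n \<Longrightarrow> aval before s' = \<sigma> 0"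
    and first: "\<And>s'. reg s' ''n'' = n \<Longrightarrow> aval first s' = \<sigma> 1"
    and advance: "\<And>c s'. c < n \<Longrightarrow> reg s' ''j'' = \<sigma> (Suc c) \<Longrightarrow> aval advance s' = \<sigma> (Suc (Suc c))"
    and cost: "acost before \<le> 2" "acost first \<le> 2" "acost advance \<le> 2"
    and consistent: "\<And>r c. r \<in> {1..m} \<Longrightarrow> c \<in> {1..n} \<Longrightarrow> \<not> (Z c r \<and> I c r)"
    and empty: "reg s ''empty'' \<in> {0, 1}"
  shows "runs (sweep A0 A1 M before first advance) s (n * (m * 200 + 100) + m * 20 + 50)
    (\<lambda>s'. frame s {''i'', ''j'', ''k'', ''c'', ''t'', ''empty''} {M, ''G''} s' \<and>
       reg s' ''empty'' \<in> {0, 1} \<and>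
       (reg s' ''empty'' = 0 \<longrightarrow>
          reg s ''empty'' = 0 \<and> least_family m n Z I (\<lambda>c. col s' M (\<sigma> c))) \<and>
       (reg s' ''empty'' = 1 \<longrightarrow>
          reg s ''empty'' = 1 \<or> \<not> (\<exists>Y. increasing_family m n Z I Y)))"
proof -
  let ?X = "{''i'', ''j'', ''k'', ''c'', ''t'', ''empty''}"
  define P where "P = (\<lambda>c s'. frame s ?X {M, ''G''} s' \<and>
      reg s' ''c'' = n - c \<and> reg s' ''k'' = \<sigma> c \<and> reg s' ''j'' = \<sigma> (Suc c) \<and>
      reg s' ''empty'' \<in> {0, 1} \<and>
      (reg s' ''empty'' = 0 \<longrightarrow>
         reg s ''empty'' = 0 \<and> least_family m c Z I (\<lambda>c. col s' M (\<sigma> c))) \<and>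
      (reg s' ''empty'' = 1 \<longrightarrow>
         reg s ''empty'' = 1 \<or> \<not> (\<exists>Y. increasing_family m n Z I Y)))"
  let ?init = "Seq (SetReg ''k'' before) (Seq (SetReg ''j'' first) (SetReg ''c'' (AReg ''n'')))"
  have init: "runs ?init s 15 (\<lambda>s1. frame s {''j'', ''k'', ''c''} {} s1 \<and>
      reg s1 ''c'' = n \<and> reg s1 ''k'' = \<sigma> 0 \<and> reg s1 ''j'' = \<sigma> 1)"
    by (rule runs_straight_line)
      (use cost before[of s] first[of "set_reg ''k'' (\<sigma> 0) s"] in \<open>auto simp: frame_def n_def\<close>)
  have clear: "runs (clear_pass M) s1 (m * 20 + 20) (P 0)"
    if s1: "frame s {''j'', ''k'', ''c''} {} s1 \<and>
      reg s1 ''c'' = n \<and> reg s1 ''k'' = \<sigma> 0 \<and> reg s1 ''j'' = \<sigma> 1" for s1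
  proof -
    have m1: "reg s1 ''m'' = m" and e1: "reg s1 ''empty'' = reg s ''empty''"
      using s1 by (auto simp: m_def frame_def)
    show ?thesis
    proof (rule runs_weaken[OF clear_pass_correct[of M s1, unfolded m1]])
      fix s'
      assume s': "frame s1 {''i''} {M} s' \<and> (\<forall>r \<in> {1..m}. \<not> col s' M (reg s1 ''k'') r)"
      then have fr': "frame s1 {''i''} {M} s'" by blast
      have "frame s ?X {M, ''G''} s'"
        using s1 fr' unfolding frame_def by auto
      with s' s1 frame_reg[OF fr'] empty e1 show "P 0 s'"
        by (auto simp: P_def least_family_def)
    qed simp
  qed
  have step: "bval (BLess (ANum 0) (AReg ''c'')) s1 \<and>
      runs (sweep_step A0 A1 M advance) s1 (m * 200 + 80) (P (Suc c))"
    if c: "c < n" and P: "P c s1" for c s1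
  proof -
    have fr1: "frame s ?X {M, ''G''} s1"
      and regs: "reg s1 ''c'' = n - c" "reg s1 ''k'' = \<sigma> c" "reg s1 ''j'' = \<sigma> (Suc c)"
      and e1: "reg s1 ''empty'' \<in> {0, 1}"
      and least: "reg s1 ''empty'' = 0 \<Longrightarrow>
         reg s ''empty'' = 0 \<and> least_family m c Z I (\<lambda>c. col s1 M (\<sigma> c))"
      and infeasible: "reg s1 ''empty'' = 1 \<Longrightarrow>
         reg s ''empty'' = 1 \<or> \<not> (\<exists>Y. increasing_family m n Z I Y)"
      using P by (auto simp: P_def)
    have m1: "reg s1 ''m'' = m" using frame_reg[OF fr1] by (simp add: m_def)
    have cols: "col s1 A0 (\<sigma> (Suc c)) = Z (Suc c)" "col s1 A1 (\<sigma> (Suc c)) = I (Suc c)"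
      using frame_arr[OF fr1] distinct by (auto simp: Z_def I_def col_def)
    have neq: "\<sigma> d \<noteq> \<sigma> (Suc c)" if "d \<le> c" for d
      using inj_onD[OF inj, of d "Suc c"] c that by auto
    let ?feas = "feasible 1 m (Z (Suc c)) (I (Suc c)) (col s1 M (\<sigma> c))"
    let ?R = "\<lambda>s2. frame s1 {''i'', ''t'', ''empty''} {M, ''G''} s2 \<and>
       (\<forall>r d. d \<noteq> \<sigma> (Suc c) \<longrightarrow> arr s2 M r d = arr s1 M r d) \<and>
       (if ?feas then reg s2 ''empty'' = reg s1 ''empty'' \<and>
          least_column m (Z (Suc c)) (I (Suc c)) (col s1 M (\<sigma> c)) (col s2 M (\<sigma> (Suc c)))
        else reg s2 ''empty'' = 1)"
    have "runs (column_prog A0 A1 M) s1 (m * 200 + 60) ?R"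
      using column_prog_correct[of A0 M A1 s1, unfolded m1 regs cols] distinct neq[of c]
        consistent[of _ "Suc c"] c by auto
    moreover have "runs (Seq (SetReg ''k'' (AReg ''j''))
        (Seq (SetReg ''j'' advance) (SetReg ''c'' (APred (AReg ''c''))))) s2 20 (P (Suc c))"
      (is "runs ?c _ _ _") if R: "?R s2" for s2
    proof (rule runs_straight_line)
      show "straight_line ?c" by simp
      show "cost_bound ?c \<le> 20" using cost by simp
      have fr2: "frame s1 {''i'', ''t'', ''empty''} {M, ''G''} s2" using R by blast
      let ?s = "effect ?c s2"
      have j2: "reg s2 ''j'' = \<sigma> (Suc c)" "reg s2 ''c'' = n - c"
        using frame_reg[OF fr2] regs by auto
      have "frame s ?X {M, ''G''} ?s"
        using fr1 fr2 by (auto simp: frame_def)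
      moreover have "reg ?s ''c'' = n - Suc c" "reg ?s ''k'' = \<sigma> (Suc c)"
          "reg ?s ''j'' = \<sigma> (Suc (Suc c))"
        using j2 advance[OF c, of "set_reg ''k'' (\<sigma> (Suc c)) s2"] by auto
      moreover have e: "reg ?s ''empty'' = (if ?feas then reg s1 ''empty'' else 1)"
        using R by auto
      moreover have colM: "col ?s M = col s2 M"
        by simp
      moreover have "reg s ''empty'' = 0 \<and> least_family m (Suc c) Z I (\<lambda>d. col ?s M (\<sigma> d))"
        if zero: "reg ?s ''empty'' = 0"
      proof -
        have feas: "?feas" and "reg s1 ''empty'' = 0"
          using zero unfolding e by (auto split: if_splits)
        with least have prev: "reg s ''empty'' = 0" "least_family m c Z I (\<lambda>d. col s1 M (\<sigma> d))"
          by auto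
        have old: "col s2 M (\<sigma> d) = col s1 M (\<sigma> d)" if "d \<le> c" for d
          using R neq[OF that] by (simp add: col_def)
        have new: "least_column m (Z (Suc c)) (I (Suc c)) (col s2 M (\<sigma> c)) (col s2 M (\<sigma> (Suc c)))"
          using R feas old[of c] by simp
        have "least_column m (Z (Suc d)) (I (Suc d)) (col s2 M (\<sigma> d)) (col s2 M (\<sigma> (Suc d)))"
          if "d < Suc c" for d
          using new prev(2) old[of d] old[of "Suc d"] that
          by (cases "d = c") (auto simp: least_family_def)
        with prev old[of 0] show ?thesis
          unfolding colM by (simp add: least_family_def)
      qed
      moreover have "reg s ''empty'' = 1 \<or> \<not> (\<exists>Y. increasing_family m n Z I Y)"
        if one: "reg ?s ''empty'' = 1"
      proof (cases "reg s1 ''empty'' = 1")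
        case True
        with infeasible show ?thesis by blast
      next
        case False
        with e1 have "reg s1 ''empty'' = 0" by simp
        with one e least have "\<not> ?feas" "least_family m c Z I (\<lambda>d. col s1 M (\<sigma> d))"
          by auto
        then show ?thesis using feasible_next_column c by blast
      qed
      ultimately show "P (Suc c) ?s"
        using e1 unfolding P_def by auto
    qed
    ultimately have "runs (sweep_step A0 A1 M advance) s1 ((m * 200 + 60) + 20) (P (Suc c))"
      unfolding sweep_step_def by (rule runs_Seq)
    then have "runs (sweep_step A0 A1 M advance) s1 (m * 200 + 80) (P (Suc c))"
      by (rule runs_weaken) auto
    with regs c show ?thesis by simp
  qed
  have stop: "\<not> bval (BLess (ANum 0) (AReg ''c'')) s'" if "P n s'" for s'
    using that by (simp add: P_def)
  have loop: "runs (While (BLess (ANum 0) (AReg ''c'')) (sweep_step A0 A1 M advance)) s'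
      (n * (m * 200 + 100) + 10) (P n)" if "P 0 s'" for s'
    by (rule runs_weaken[OF runs_While[where P=P, OF that step stop]])
      (auto simp: algebra_simps)
  have "runs (sweep A0 A1 M before first advance) s
      (15 + ((m * 20 + 20) + (n * (m * 200 + 100) + 10))) (P n)"
    unfolding sweep_def by (rule runs_Seq[OF init runs_Seq[OF clear loop]])
  then show ?thesis by (rule runs_weaken) (auto simp: P_def)
qed

section \<open>Reading off the fixed entries\<close>

text \<open>
  \<open>U\<close> holds the complement of the greatest solution, hence agreement of the two solutions means that
  the entries of \<open>L\<close> and \<open>U\<close> differ.
\<close>

definition agree_test :: bexp where
  "agree_test =
     BAnd (BNot (BAnd (is_one ''L'' (AReg ''i'') (AReg ''j'')) (is_one ''U'' (AReg ''i'') (AReg ''j''))))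
       (BNot (BAnd (BNot (is_one ''L'' (AReg ''i'') (AReg ''j'')))
                   (BNot (is_one ''U'' (AReg ''i'') (AReg ''j'')))))"

definition read_off_step :: com where
  "read_off_step =
     Seq (Cond (BAnd (BEq (AReg ''t'') (ANum 1)) agree_test)
           (Cond (is_one ''L'' (AReg ''i'') (AReg ''j''))
             (Seq (SetEntry ''J0'' (AReg ''i'') (AReg ''j'') (ANum 0))
                  (SetEntry ''J1'' (AReg ''i'') (AReg ''j'') (ANum 1)))
             (Seq (SetEntry ''J0'' (AReg ''i'') (AReg ''j'') (ANum 1))
                  (SetEntry ''J1'' (AReg ''i'') (AReg ''j'') (ANum 0))))
           (Seq (SetReg ''t'' (ANum 0))
             (Seq (SetEntry ''J0'' (AReg ''i'') (AReg ''j'') (AEntry ''I0'' (AReg ''i'') (AReg ''j'')))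
                  (SetEntry ''J1'' (AReg ''i'') (AReg ''j'') (AEntry ''I1'' (AReg ''i'') (AReg ''j''))))))
         (SetReg ''i'' (ASucc (AReg ''i'')))"

definition read_off_column :: com where
  "read_off_column =
     Seq (Seq (SetReg ''t'' (ANum 1)) (SetReg ''i'' (ANum 1)))
       (While (BLess (AReg ''i'') (ASucc (AReg ''m''))) read_off_step)"

definition read_off :: com where
  "read_off =
     Seq (SetReg ''j'' (ANum 1))
       (While (BLess (AReg ''j'') (ASucc (AReg ''n'')))
         (Seq read_off_column (SetReg ''j'' (ASucc (AReg ''j'')))))"

text \<open>
  The right-hand side of \<open>common_value_iff\<close>, expressed by the contents of the arrays.
\<close>

definition fixed_entry :: "state \<Rightarrow> bool \<Rightarrow> nat \<Rightarrow> nat \<Rightarrow> bool" where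
  "fixed_entry s b i j \<longleftrightarrow>
     (if \<forall>r \<in> {1..i}. col s ''L'' j r = (\<not> col s ''U'' j r) then col s ''L'' j i = b
      else col s (if b then ''I1'' else ''I0'') j i)"

lemma read_off_column_correct:
  fixes s :: state
  defines "m \<equiv> reg s ''m''" and "j \<equiv> reg s ''j''"
  assumes binary: "\<And>r. r \<in> {1..m} \<Longrightarrow> arr s ''I0'' r j \<in> {0, 1} \<and> arr s ''I1'' r j \<in> {0, 1}"
  shows "runs read_off_column s (m * 100 + 20)
    (\<lambda>s'. frame s {''i'', ''t''} {''J0'', ''J1''} s' \<and>
       (\<forall>r c. c \<noteq> j \<longrightarrow> arr s' ''J0'' r c = arr s ''J0'' r c \<and> arr s' ''J1'' r c = arr s ''J1'' r c) \<and>
       (\<forall>r \<in> {1..m}. arr s' ''J0'' r j = of_bool (fixed_entry s False r j) \<and>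
                     arr s' ''J1'' r j = of_bool (fixed_entry s True r j)))"
proof -
  let ?agree = "\<lambda>r. col s ''L'' j r = (\<not> col s ''U'' j r)"
  define P where "P = (\<lambda>l s'. frame s {''i'', ''t''} {''J0'', ''J1''} s' \<and> reg s' ''i'' = Suc l \<and>
    (reg s' ''t'' = 1 \<longleftrightarrow> (\<forall>r \<in> {1..l}. ?agree r)) \<and>
    (\<forall>r c. c \<noteq> j \<longrightarrow> arr s' ''J0'' r c = arr s ''J0'' r c \<and> arr s' ''J1'' r c = arr s ''J1'' r c) \<and>
    (\<forall>r \<in> {1..l}. arr s' ''J0'' r j = of_bool (fixed_entry s False r j) \<and>
                  arr s' ''J1'' r j = of_bool (fixed_entry s True r j)))"
  have init: "runs (Seq (SetReg ''t'' (ANum 1)) (SetReg ''i'' (ANum 1))) s 10 (P 0)"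
    by (rule runs_straight_line) (auto simp: P_def frame_def)
  have step: "bval (BLess (AReg ''i'') (ASucc (AReg ''m''))) s' \<and>
      runs read_off_step s' 90 (P (Suc l))" if l: "l < m" and P: "P l s'" for l s'
  proof -
    define i where "i = Suc l"
    have i: "1 \<le> i" "i \<le> m" "{1..i} = insert i {1..l}" "i \<notin> {1..l}"
      using l by (auto simp: i_def)
    have fr: "frame s {''i'', ''t''} {''J0'', ''J1''} s'" and ri: "reg s' ''i'' = i"
      and t: "reg s' ''t'' = 1 \<longleftrightarrow> (\<forall>r \<in> {1..l}. ?agree r)"
      and other: "\<And>r c. c \<noteq> j \<Longrightarrow> arr s' ''J0'' r c = arr s ''J0'' r c"
        "\<And>r c. c \<noteq> j \<Longrightarrow> arr s' ''J1'' r c = arr s ''J1'' r c"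
      and earlier: "\<And>r. r \<in> {1..l} \<Longrightarrow> arr s' ''J0'' r j = of_bool (fixed_entry s False r j)"
        "\<And>r. r \<in> {1..l} \<Longrightarrow> arr s' ''J1'' r j = of_bool (fixed_entry s True r j)"
      using P by (auto simp: P_def i_def)
    have regs: "reg s' ''j'' = j" "reg s' ''m'' = m"
      using frame_reg[OF fr] by (auto simp: j_def m_def)
    have arrs: "arr s' ''L'' = arr s ''L''" "arr s' ''U'' = arr s ''U''"
        "arr s' ''I0'' = arr s ''I0''" "arr s' ''I1'' = arr s ''I1''"
      using frame_arr[OF fr] by auto
    have test: "bval (BAnd (BEq (AReg ''t'') (ANum 1)) agree_test) s' \<longleftrightarrow> (\<forall>r \<in> {1..i}. ?agree r)"
      unfolding i(3) using t by (auto simp: agree_test_def col_def ri regs arrs)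
    have entry: "fixed_entry s b i j =
        (if bval (BAnd (BEq (AReg ''t'') (ANum 1)) agree_test) s' then (arr s ''L'' i j = 1) = b
         else arr s (if b then ''I1'' else ''I0'') i j = 1)" for b
      unfolding test fixed_entry_def by (simp add: col_def)
    have bin: "arr s ''I0'' i j \<in> {0, 1}" "arr s ''I1'' i j \<in> {0, 1}"
      using binary[of i] i by auto
    have "runs read_off_step s' 90 (P (Suc l))"
    proof (rule runs_straight_line)
      show "straight_line read_off_step" by (simp add: read_off_step_def)
      show "cost_bound read_off_step \<le> 90"
        by (simp add: read_off_step_def agree_test_def)
      let ?s = "effect read_off_step s'"
      have "frame s {''i'', ''t''} {''J0'', ''J1''} ?s"
        using fr by (auto simp: frame_def read_off_step_def)
      moreover have "reg ?s ''i'' = Suc i"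
        by (simp add: read_off_step_def ri)
      moreover have "reg ?s ''t'' = 1 \<longleftrightarrow> (\<forall>r \<in> {1..i}. ?agree r)"
        unfolding test[symmetric] by (simp add: read_off_step_def)
      moreover have "arr ?s ''J0'' r c = arr s ''J0'' r c" "arr ?s ''J1'' r c = arr s ''J1'' r c"
        if "c \<noteq> j" for r c
        using that other[OF that] by (auto simp: read_off_step_def regs)
      moreover have "arr ?s ''J0'' i j = of_bool (fixed_entry s False i j)"
          "arr ?s ''J1'' i j = of_bool (fixed_entry s True i j)"
        unfolding entry using bin by (auto simp: read_off_step_def ri regs arrs)
      moreover have "arr ?s ''J0'' r j = of_bool (fixed_entry s False r j)"
          "arr ?s ''J1'' r j = of_bool (fixed_entry s True r j)" if "r \<in> {1..l}" for r
        using that earlier[OF that] i(4) by (auto simp: read_off_step_def ri)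
      ultimately show "P (Suc l) ?s"
        unfolding P_def i_def[symmetric] i(3) by blast
    qed
    with ri regs i show ?thesis by simp
  qed
  have stop: "\<not> bval (BLess (AReg ''i'') (ASucc (AReg ''m''))) s'" if "P m s'" for s'
    using that frame_reg[of s "{''i'', ''t''}" "{''J0'', ''J1''}" s' "''m''"]
    by (simp add: P_def m_def)
  have "runs (While (BLess (AReg ''i'') (ASucc (AReg ''m''))) read_off_step) s'
      (m * 100 + 10) (P m)" if "P 0 s'" for s'
    by (rule runs_weaken[OF runs_While[where P=P, OF that step stop]]) auto
  from runs_Seq[OF init this] show ?thesis
    unfolding read_off_column_def by (rule runs_weaken) (auto simp: P_def)
qed

lemma read_off_correct:
  fixes s :: state
  defines "m \<equiv> reg s ''m''" and "n \<equiv> reg s ''n''"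
  assumes binary: "\<And>i j. i \<in> {1..m} \<Longrightarrow> j \<in> {1..n} \<Longrightarrow>
    arr s ''I0'' i j \<in> {0, 1} \<and> arr s ''I1'' i j \<in> {0, 1}"
  shows "runs read_off s (n * (m * 100 + 50) + 20)
    (\<lambda>s'. reg s' ''empty'' = reg s ''empty'' \<and>
       (\<forall>i \<in> {1..m}. \<forall>j \<in> {1..n}. arr s' ''J0'' i j = of_bool (fixed_entry s False i j) \<and>
                                   arr s' ''J1'' i j = of_bool (fixed_entry s True i j)))"
proof -
  let ?X = "{''i'', ''j'', ''t''}"
  define P where "P = (\<lambda>l s'. frame s ?X {''J0'', ''J1''} s' \<and> reg s' ''j'' = Suc l \<and>
    (\<forall>i \<in> {1..m}. \<forall>j \<in> {1..l}. arr s' ''J0'' i j = of_bool (fixed_entry s False i j) \<and>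
                                arr s' ''J1'' i j = of_bool (fixed_entry s True i j)))"
  have init: "runs (SetReg ''j'' (ANum 1)) s 10 (P 0)"
    by (rule runs_straight_line) (auto simp: P_def frame_def)
  have step: "bval (BLess (AReg ''j'') (ASucc (AReg ''n''))) s1 \<and>
      runs (Seq read_off_column (SetReg ''j'' (ASucc (AReg ''j'')))) s1 (m * 100 + 30) (P (Suc l))"
    if l: "l < n" and P: "P l s1" for l s1
  proof -
    have fr1: "frame s ?X {''J0'', ''J1''} s1" and rj: "reg s1 ''j'' = Suc l"
      and earlier: "\<And>i j. i \<in> {1..m} \<Longrightarrow> j \<in> {1..l} \<Longrightarrow>
        arr s1 ''J0'' i j = of_bool (fixed_entry s False i j) \<and>
        arr s1 ''J1'' i j = of_bool (fixed_entry s True i j)"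
      using P by (auto simp: P_def)
    have regs: "reg s1 ''m'' = m" "reg s1 ''n'' = n"
      using frame_reg[OF fr1] by (auto simp: m_def n_def)
    have arrs: "arr s1 ''L'' = arr s ''L''" "arr s1 ''U'' = arr s ''U''"
        "arr s1 ''I0'' = arr s ''I0''" "arr s1 ''I1'' = arr s ''I1''"
      using frame_arr[OF fr1] by auto
    then have "fixed_entry s1 = fixed_entry s"
      by (auto simp: fixed_entry_def col_def fun_eq_iff)
    note column = read_off_column_correct[of s1, unfolded regs rj this arrs]
    show ?thesis
    proof
      show "bval (BLess (AReg ''j'') (ASucc (AReg ''n''))) s1"
        using l by (simp add: rj regs)
      have "runs (Seq read_off_column (SetReg ''j'' (ASucc (AReg ''j'')))) s1
          ((m * 100 + 20) + 10) (P (Suc l))"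
      proof (rule runs_Seq[OF column])
        show "arr s ''I0'' r (Suc l) \<in> {0, 1} \<and> arr s ''I1'' r (Suc l) \<in> {0, 1}"
          if "r \<in> {1..m}" for r
          using binary[OF that, of "Suc l"] l by simp
      next
        fix s2
        assume s2: "frame s1 {''i'', ''t''} {''J0'', ''J1''} s2 \<and>
         (\<forall>r c. c \<noteq> Suc l \<longrightarrow>
            arr s2 ''J0'' r c = arr s1 ''J0'' r c \<and> arr s2 ''J1'' r c = arr s1 ''J1'' r c) \<and>
         (\<forall>r \<in> {1..m}. arr s2 ''J0'' r (Suc l) = of_bool (fixed_entry s False r (Suc l)) \<and>
                       arr s2 ''J1'' r (Suc l) = of_bool (fixed_entry s True r (Suc l)))"
        have fr2: "frame s1 {''i'', ''t''} {''J0'', ''J1''} s2" using s2 by blast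
        show "runs (SetReg ''j'' (ASucc (AReg ''j''))) s2 10 (P (Suc l))"
        proof (rule runs_straight_line)
          let ?s = "effect (SetReg ''j'' (ASucc (AReg ''j''))) s2"
          have "frame s ?X {''J0'', ''J1''} ?s"
            using fr1 fr2 by (auto simp: frame_def)
          moreover have "reg ?s ''j'' = Suc (Suc l)"
            using frame_reg[OF fr2, of "''j''"] rj by simp
          moreover have "arr ?s ''J0'' i j = of_bool (fixed_entry s False i j) \<and>
              arr ?s ''J1'' i j = of_bool (fixed_entry s True i j)"
            if "i \<in> {1..m}" "j \<in> {1..Suc l}" for i j
            using s2 earlier[of i j] that by (cases "j = Suc l") auto
          ultimately show "P (Suc l) ?s" unfolding P_def by blast
        qed auto
      qed
      then show "runs (Seq read_off_column (SetReg ''j'' (ASucc (AReg ''j'')))) s1 (m * 100 + 30) (P (Suc l))"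
        by (rule runs_weaken) auto
    qed
  qed
  have stop: "\<not> bval (BLess (AReg ''j'') (ASucc (AReg ''n''))) s'" if "P n s'" for s'
    using that frame_reg[of s ?X "{''J0'', ''J1''}" s' "''n''"] by (simp add: P_def n_def)
  have "runs (While (BLess (AReg ''j'') (ASucc (AReg ''n'')))
         (Seq read_off_column (SetReg ''j'' (ASucc (AReg ''j''))))) s' (n * (m * 100 + 50) + 10) (P n)"
    if "P 0 s'" for s'
    by (rule runs_weaken[OF runs_While[where P=P, OF that step stop]]) (auto simp: algebra_simps)
  from runs_Seq[OF init this] show ?thesis
    unfolding read_off_def by (rule runs_weaken) (auto simp: P_def frame_def)
qed

section \<open>Orbitopal fixing in linear time\<close>

text \<open>
  The first sweep computes the least solution into \<open>L\<close> from right to left, the second the complement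
  of the greatest one into \<open>U\<close> from left to right, with the prescriptions exchanged.
\<close>

definition fixing_prog :: com where
  "fixing_prog =
     Seq (SetReg ''empty'' (ANum 0))
      (Seq (sweep ''I0'' ''I1'' ''L'' (ASucc (AReg ''n'')) (AReg ''n'') (APred (AReg ''j'')))
        (Seq (sweep ''I1'' ''I0'' ''U'' (ANum 0) (ANum 1) (ASucc (AReg ''j'')))
          read_off))"

lemma fixing_prog_correct:
  assumes "1 \<le> m" "1 \<le> n" and idx: "index_sets m n I0 I1" and input: "holds_input s m n I0 I1"
  shows "runs fixing_prog s (1000 * (m * n))
    (\<lambda>s'. if solutions m n I0 I1 = {} then reg s' ''empty'' = 1
          else reg s' ''empty'' = 0 \<and>
            stores_set s' ''J0'' m n (common m n I0 I1 False) \<and>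
            stores_set s' ''J1'' m n (common m n I0 I1 True))"
    (is "runs _ _ _ ?Q")
proof -
  let ?S = "solutions m n I0 I1"
  have in_regs: "reg s ''m'' = m" "reg s ''n'' = n"
    and in_I0: "\<And>i j. i \<in> {1..m} \<Longrightarrow> j \<in> {1..n} \<Longrightarrow> arr s ''I0'' i j = of_bool ((i, j) \<in> I0)"
    and in_I1: "\<And>i j. i \<in> {1..m} \<Longrightarrow> j \<in> {1..n} \<Longrightarrow> arr s ''I1'' i j = of_bool ((i, j) \<in> I1)"
    using input by (auto simp: holds_input_def stores_set_def)
  have disjoint: "I0 \<inter> I1 = {}" using idx by (simp add: index_sets_def)
  define down where "down = (\<lambda>c. Suc n - c)"
  have family_cong: "increasing_family m n Z I Y \<longleftrightarrow> increasing_family m n Z' I' Y"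
    if "\<And>c r. c \<in> {1..n} \<Longrightarrow> r \<in> {1..m} \<Longrightarrow> Z c r = Z' c r \<and> I c r = I' c r" for Z I Z' I' Y
    using that by (auto simp: increasing_family_def fits_def)

  let ?R1 = "\<lambda>s1. reg s1 ''m'' = m \<and> reg s1 ''n'' = n \<and>
      arr s1 ''I0'' = arr s ''I0'' \<and> arr s1 ''I1'' = arr s ''I1'' \<and> reg s1 ''empty'' = 0"
  have init: "runs (SetReg ''empty'' (ANum 0)) s 2 ?R1"
    by (rule runs_straight_line) (auto simp: in_regs)

  let ?lo = "\<lambda>s j. col s ''L'' j" and ?hi = "\<lambda>s j r. \<not> col s ''U'' j r"
  let ?R2 = "\<lambda>s2. reg s2 ''m'' = m \<and> reg s2 ''n'' = n \<and>
      arr s2 ''I0'' = arr s ''I0'' \<and> arr s2 ''I1'' = arr s ''I1'' \<and> reg s2 ''empty'' \<in> {0, 1} \<and>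
      (reg s2 ''empty'' = 1 \<longrightarrow> ?S = {}) \<and>
      (reg s2 ''empty'' = 0 \<longrightarrow> ?lo s2 \<in> ?S \<and>
         (\<forall>Y \<in> ?S. \<forall>j \<in> {1..n}. lex_le 1 m (?lo s2 j) (Y j)))"
  have lower: "runs (sweep ''I0'' ''I1'' ''L'' (ASucc (AReg ''n'')) (AReg ''n'') (APred (AReg ''j''))) s1
      (n * (m * 200 + 100) + m * 20 + 50) ?R2" if s1: "?R1 s1" for s1
  proof -
    let ?Z = "\<lambda>c. col s1 ''I0'' (down c)" and ?I = "\<lambda>c. col s1 ''I1'' (down c)"
    have ZI: "?Z c r \<longleftrightarrow> (r, down c) \<in> I0" "?I c r \<longleftrightarrow> (r, down c) \<in> I1"
      if "c \<in> {1..n}" "r \<in> {1..m}" for c r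
    proof -
      have d: "down c \<in> {1..n}" using that(1) by (auto simp: down_def)
      show "?Z c r \<longleftrightarrow> (r, down c) \<in> I0" "?I c r \<longleftrightarrow> (r, down c) \<in> I1"
        using s1 in_I0[OF that(2) d] in_I1[OF that(2) d] by (simp_all add: col_def)
    qed
    have sol: "Y \<in> ?S \<longleftrightarrow> increasing_family m n ?Z ?I (\<lambda>c. Y (down c))" for Y
      unfolding solutions_iff_increasing_family down_def[symmetric]
      using ZI by (subst family_cong[of _ ?Z _ ?I]) (auto simp: down_def)
    have regs: "reg s1 ''m'' = m" "reg s1 ''n'' = n" using s1 by auto
    show ?thesis
    proof (rule runs_weaken[OF sweep_correct[of "''I0''" "''L''" "''I1''" down s1, unfolded regs]])
      show "inj_on down {0..n}" by (auto simp: inj_on_def down_def)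
      show "\<not> (?Z c r \<and> ?I c r)" if "r \<in> {1..m}" "c \<in> {1..n}" for r c
        using ZI[OF that(2,1)] disjoint by auto
      fix s2
      assume s2: "frame s1 {''i'', ''j'', ''k'', ''c'', ''t'', ''empty''} {''L'', ''G''} s2 \<and>
        reg s2 ''empty'' \<in> {0, 1} \<and>
        (reg s2 ''empty'' = 0 \<longrightarrow>
          reg s1 ''empty'' = 0 \<and> least_family m n ?Z ?I (\<lambda>c. col s2 ''L'' (down c))) \<and>
        (reg s2 ''empty'' = 1 \<longrightarrow>
          reg s1 ''empty'' = 1 \<or> \<not> (\<exists>Y. increasing_family m n ?Z ?I Y))"
      then have fr: "frame s1 {''i'', ''j'', ''k'', ''c'', ''t'', ''empty''} {''L'', ''G''} s2"
        by blast
      have "?S = {}" if "reg s2 ''empty'' = 1"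
        using s2 s1 that sol by auto
      moreover have "?lo s2 \<in> ?S \<and> (\<forall>Y \<in> ?S. \<forall>j \<in> {1..n}. lex_le 1 m (?lo s2 j) (Y j))"
        if "reg s2 ''empty'' = 0"
      proof -
        have least: "least_family m n ?Z ?I (\<lambda>c. ?lo s2 (down c))" using s2 that by auto
        have "lex_le 1 m (?lo s2 j) (Y j)" if "Y \<in> ?S" "j \<in> {1..n}" for Y j
        proof -
          have "down j \<in> {1..n}" "down (down j) = j" using that(2) by (auto simp: down_def)
          with least_family_le[OF least, of n "\<lambda>c. Y (down c)" "down j"] sol that(1)
          show ?thesis by simp
        qed
        with least_family_increasing[OF least] sol show ?thesis by blast
      qed
      ultimately show "?R2 s2"
        using s2 s1 frame_reg[OF fr] frame_arr[OF fr] by auto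
    qed (use s1 in \<open>auto simp: down_def\<close>)
  qed

  let ?R3 = "\<lambda>s3. reg s3 ''m'' = m \<and> reg s3 ''n'' = n \<and>
      arr s3 ''I0'' = arr s ''I0'' \<and> arr s3 ''I1'' = arr s ''I1'' \<and> reg s3 ''empty'' \<in> {0, 1} \<and>
      (reg s3 ''empty'' = 1 \<longrightarrow> ?S = {}) \<and>
      (reg s3 ''empty'' = 0 \<longrightarrow> ?lo s3 \<in> ?S \<and> ?hi s3 \<in> ?S \<and>
         (\<forall>Y \<in> ?S. \<forall>j \<in> {1..n}. lex_le 1 m (?lo s3 j) (Y j) \<and> lex_le 1 m (Y j) (?hi s3 j)))"
  have upper: "runs (sweep ''I1'' ''I0'' ''U'' (ANum 0) (ANum 1) (ASucc (AReg ''j''))) s2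
      (n * (m * 200 + 100) + m * 20 + 50) ?R3" if s2: "?R2 s2" for s2
  proof -
    let ?Z = "\<lambda>c. col s2 ''I1'' c" and ?I = "\<lambda>c. col s2 ''I0'' c"
    have ZI: "?Z c r \<longleftrightarrow> (r, c) \<in> I1" "?I c r \<longleftrightarrow> (r, c) \<in> I0"
      if "c \<in> {1..n}" "r \<in> {1..m}" for c r
      using s2 in_I0[OF that(2,1)] in_I1[OF that(2,1)] by (simp_all add: col_def)
    have sol: "Y \<in> ?S \<longleftrightarrow> increasing_family m n ?Z ?I (\<lambda>c r. \<not> Y c r)" for Y
      unfolding solutions_iff_increasing_complement
      using ZI by (subst family_cong[of _ ?Z _ ?I]) auto
    have regs: "reg s2 ''m'' = m" "reg s2 ''n'' = n" using s2 by auto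
    show ?thesis
    proof (rule runs_weaken[OF sweep_correct[of "''I1''" "''U''" "''I0''" "\<lambda>c. c" s2, unfolded regs]])
      show "\<not> (?Z c r \<and> ?I c r)" if "r \<in> {1..m}" "c \<in> {1..n}" for r c
        using ZI[OF that(2,1)] disjoint by auto
      fix s3
      assume s3: "frame s2 {''i'', ''j'', ''k'', ''c'', ''t'', ''empty''} {''U'', ''G''} s3 \<and>
        reg s3 ''empty'' \<in> {0, 1} \<and>
        (reg s3 ''empty'' = 0 \<longrightarrow>
          reg s2 ''empty'' = 0 \<and> least_family m n ?Z ?I (\<lambda>c. col s3 ''U'' c)) \<and>
        (reg s3 ''empty'' = 1 \<longrightarrow>
          reg s2 ''empty'' = 1 \<or> \<not> (\<exists>Y. increasing_family m n ?Z ?I Y))"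
      then have fr: "frame s2 {''i'', ''j'', ''k'', ''c'', ''t'', ''empty''} {''U'', ''G''} s3"
        by blast
      have L: "?lo s3 = ?lo s2"
        using frame_arr[OF fr] by (simp add: col_def)
      have "?S = {}" if "reg s3 ''empty'' = 1"
        using s3 s2 that sol by auto
      moreover have "?lo s3 \<in> ?S \<and> ?hi s3 \<in> ?S \<and>
         (\<forall>Y \<in> ?S. \<forall>j \<in> {1..n}. lex_le 1 m (?lo s3 j) (Y j) \<and> lex_le 1 m (Y j) (?hi s3 j))"
        if "reg s3 ''empty'' = 0"
      proof -
        have least: "least_family m n ?Z ?I (\<lambda>c. col s3 ''U'' c)" and "reg s2 ''empty'' = 0"
          using s3 that by auto
        then have lo: "?lo s3 \<in> ?S" "\<forall>Y \<in> ?S. \<forall>j \<in> {1..n}. lex_le 1 m (?lo s3 j) (Y j)"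
          using s2 unfolding L by auto
        have "lex_le 1 m (Y j) (?hi s3 j)" if "Y \<in> ?S" "j \<in> {1..n}" for Y j
        proof -
          have "lex_le 1 m (col s3 ''U'' j) (\<lambda>r. \<not> Y j r)"
            using least_family_le[OF least, of n "\<lambda>c r. \<not> Y c r" j] sol that by simp
          then show ?thesis
            using lex_le_complement[of 1 m "?hi s3 j" "Y j"] by simp
        qed
        moreover have "?hi s3 \<in> ?S"
          using least_family_increasing[OF least] sol[of "?hi s3"] by simp
        ultimately show ?thesis using lo by blast
      qed
      ultimately show "?R3 s3"
        using s3 s2 frame_reg[OF fr] frame_arr[OF fr] by auto
    qed (use s2 in auto)
  qed

  have final: "runs read_off s3 (n * (m * 100 + 50) + 20) ?Q" if s3: "?R3 s3" for s3
  proof -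
    have regs: "reg s3 ''m'' = m" "reg s3 ''n'' = n" using s3 by auto
    show ?thesis
    proof (rule runs_weaken[OF read_off_correct[of s3, unfolded regs]])
      show "arr s3 ''I0'' i j \<in> {0, 1} \<and> arr s3 ''I1'' i j \<in> {0, 1}"
        if "i \<in> {1..m}" "j \<in> {1..n}" for i j
        using s3 in_I0[OF that] in_I1[OF that] by simp
      fix s4 :: state
      assume s4: "reg s4 ''empty'' = reg s3 ''empty'' \<and>
       (\<forall>i \<in> {1..m}. \<forall>j \<in> {1..n}. arr s4 ''J0'' i j = of_bool (fixed_entry s3 False i j) \<and>
                                   arr s4 ''J1'' i j = of_bool (fixed_entry s3 True i j))"
      show "?Q s4"
      proof (cases "?S = {}")
        case True
        with s3 s4 show ?thesis by auto
      next
        case False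
        with s3 have empty: "reg s3 ''empty'' = 0" by auto
        with s3 have lo: "?lo s3 \<in> ?S" and hi: "?hi s3 \<in> ?S"
          and bounds: "\<And>Y j. Y \<in> ?S \<Longrightarrow> j \<in> {1..n} \<Longrightarrow>
            lex_le 1 m (?lo s3 j) (Y j) \<and> lex_le 1 m (Y j) (?hi s3 j)"
          by auto
        have entry: "fixed_entry s3 b i j \<longleftrightarrow> (i, j) \<in> common m n I0 I1 b"
          if i: "i \<in> {1..m}" and j: "j \<in> {1..n}" for b i j
        proof -
          have "col s3 (if b then ''I1'' else ''I0'') j i \<longleftrightarrow> (i, j) \<in> (if b then I1 else I0)"
            using s3 in_I0[OF i j] in_I1[OF i j] by (simp add: col_def)
          moreover have "(\<forall>Y \<in> ?S. Y j i = b) \<longleftrightarrow>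
              (if \<forall>r \<in> {1..i}. ?lo s3 j r = ?hi s3 j r then ?lo s3 j i = b
               else (i, j) \<in> (if b then I1 else I0))"
            by (rule common_value_iff[of m n I0 I1 "?lo s3" "?hi s3" j i b])
              (fact idx lo hi i j | erule bounds[OF _ j])+
          ultimately have "fixed_entry s3 b i j \<longleftrightarrow> (\<forall>Y \<in> ?S. Y j i = b)"
            by (simp only: fixed_entry_def)
          then show ?thesis using i j by (simp add: common_def grid_def)
        qed
        with s4 empty False show ?thesis by (simp add: stores_set_def of_bool_def)
      qed
    qed simp
  qed
  have "runs fixing_prog s (2 + ((n * (m * 200 + 100) + m * 20 + 50) +
      ((n * (m * 200 + 100) + m * 20 + 50) + (n * (m * 100 + 50) + 20)))) ?Q"
    unfolding fixing_prog_def
    by (rule runs_Seq[OF init runs_Seq[OF lower runs_Seq[OF upper final]]])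
  then show ?thesis
  proof (rule runs_weaken)
    \<comment> \<open>As \<open>m\<close> and \<open>n\<close> are positive, the lower-order terms are absorbed by the product.\<close>
    have "m \<le> m * n" "n \<le> m * n" "1 \<le> m * n" using assms(1,2) by auto
    moreover have "2 + ((n * (m * 200 + 100) + m * 20 + 50) +
      ((n * (m * 200 + 100) + m * 20 + 50) + (n * (m * 100 + 50) + 20))) =
      500 * (m * n) + 250 * n + 40 * m + 122"
      by (simp add: algebra_simps)
    ultimately show "2 + ((n * (m * 200 + 100) + m * 20 + 50) +
      ((n * (m * 200 + 100) + m * 20 + 50) + (n * (m * 100 + 50) + 20))) \<le> 1000 * (m * n)"
      by linarith
  qed
qed

theorem theorem3:
  shows "\<exists>(prog :: com) (K :: nat). \<forall>(m :: nat) (n :: nat) I0 I1 F s.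
     1 \<le> m \<longrightarrow> 1 \<le> n \<longrightarrow>
     index_sets m n I0 I1 \<longrightarrow> F = face m n I0 I1 \<longrightarrow> F \<noteq> {} \<longrightarrow>
     holds_input s m n I0 I1 \<longrightarrow>
     (\<exists>t s'. exec prog s t s' \<and> t \<le> K * (m * n) \<and>
        (if Fix m n F (full_orbitope m n) = {}
         then reg s' ''empty'' = 1
         else reg s' ''empty'' = 0 \<and>
           (\<exists>J0 J1. index_sets m n J0 J1 \<and>
              Fix m n F (full_orbitope m n) = face m n J0 J1 \<and>
              stores_set s' ''J0'' m n J0 \<and> stores_set s' ''J1'' m n J1)))"
proof (rule exI[of _ fixing_prog], rule exI[of _ 1000], intro allI impI)
  fix m n :: nat and I0 I1 F s
  assume "1 \<le> m" "1 \<le> n" and idx: "index_sets m n I0 I1" and F: "F = face m n I0 I1"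
    and "holds_input s m n I0 I1"
  then obtain t s' where run: "exec fixing_prog s t s'" "t \<le> 1000 * (m * n)"
    and result: "if solutions m n I0 I1 = {} then reg s' ''empty'' = 1
          else reg s' ''empty'' = 0 \<and>
            stores_set s' ''J0'' m n (common m n I0 I1 False) \<and>
            stores_set s' ''J1'' m n (common m n I0 I1 True)"
    using fixing_prog_correct unfolding runs_def by blast
  have "if Fix m n F (full_orbitope m n) = {} then reg s' ''empty'' = 1
     else reg s' ''empty'' = 0 \<and>
       (\<exists>J0 J1. index_sets m n J0 J1 \<and> Fix m n F (full_orbitope m n) = face m n J0 J1 \<and>
          stores_set s' ''J0'' m n J0 \<and> stores_set s' ''J1'' m n J1)"
  proof (cases "solutions m n I0 I1 = {}")
    case True
    with result show ?thesis by (simp add: F Fix_full_orbitope_empty_iff[OF idx])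
  next
    case False
    with result Fix_full_orbitope_nonempty[OF idx False] Fix_full_orbitope_empty_iff[OF idx]
    show ?thesis unfolding F by auto
  qed
  with run show "\<exists>t s'. exec fixing_prog s t s' \<and> t \<le> 1000 * (m * n) \<and>
        (if Fix m n F (full_orbitope m n) = {}
         then reg s' ''empty'' = 1
         else reg s' ''empty'' = 0 \<and>
           (\<exists>J0 J1. index_sets m n J0 J1 \<and>
              Fix m n F (full_orbitope m n) = face m n J0 J1 \<and>
              stores_set s' ''J0'' m n J0 \<and> stores_set s' ''J1'' m n J1))"
    by blast
qed

end
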